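(* Let $d\ge 2$ and let $\mathcal P=\{P_1,\dots,P_{d+4}\}\subset\mathbb{P}^d$ (over $\mathbb{C}$) be a set of $d+4$ distinct points lying on a rational normal curve of degree $d$. For each $6$-element subset $\lambda=\{i_1<\dots<i_6\}$ of $\{1,\dots,d+4\}$, with complement $\{j_1<\dots<j_{d-2}\}$, write $H_\lambda=j_1\cdots j_{d-2}$, and let $$\mathcal Q=\bigcup_{\lambda=\{i_1<\dots<i_6\}}\left\{ i_1i_2\wedge i_4i_5H_\lambda,\ \ i_2i_3\wedge i_5i_6H_\lambda,\ \ i_3i_4\wedge i_6i_1H_\lambda\right\},$$ where $ab\wedge ceH_\lambda$ denotes the point of $\mathbb{P}^d$ in which the line $\overline{P_aP_b}$ meets the hyperplane spanned by $P_c,P_e,P_{j_1},\dots,P_{j_{d-2}}$. Let $n=d+4+|\mathcal Q|$, let $A_{\rm CS}$ be the $(d+1)\times n$ matrix whose columns are homogeneous coordinates of the points of $\mathcal P$ followed by those of the points of $\mathcal Q$, and let $x_{\rm CS}\in \mathrm{Gr}(d+1,n)$ be the subspace spanned by the rows of $A_{\rm CS}$. Then there are nontrivial quartics in $I_{\rm CS}=I_{x_{\rm CS}}$.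
   Context: A rational normal curve of degree $d$ in $\mathbb{P}^d$ is the image of a map $\mathbb{P}^1\to\mathbb{P}^d$, $[x_0:x_1]\mapsto[F_0:\cdots:F_d]$, where $F_0,\dots,F_d$ is a basis of the homogeneous forms of degree $d$ on $\mathbb{P}^1$. The set $\mathcal Q$ is a set of points of $\mathbb{P}^d$, so a point arising from several $\lambda$ is counted only once. For $x\in \mathrm{Gr}(r,n)$ (the Grassmannian of $r$-dimensional subspaces of $\mathbb{C}^n$), let $A_x$ be any $r\times n$ matrix whose rows form a basis of the subspace $x$. $\mathscr{M}_x$ is the matroid on $\Omega_n=\{1,\dots,n\}$ whose bases are the sets $\lambda$ of $r$ indices such that the columns of $A_x$ indexed by $\lambda$ are linearly independent. $\Gamma_x=\{y\in \mathrm{Gr}(r,n): \mathscr{M}_y=\mathscr{M}_x\}$ and the matroid variety is the Zariski closure $\mathcal{V}_x=\overline{\Gamma_x}\subset \mathrm{Gr}(r,n)$. For an $r$-element subset $\lambda=\{\lambda_1<\dots<\lambda_r\}$ of $\Omega_n$, the bracket $[\lambda]=[\lambda_1\cdots\lambda_r]$ is the Plücker coordinate given by the $r\times r$ minor on the columns $\lambda_1,\dots,\lambda_r$. $\mathbb{C}[\mathrm{Gr}(r,n)]$ is the homogeneous coordinate ring of the Grassmannian in its Plücker embedding, i.e. the polynomial ring in the brackets modulo the ideal of Plücker relations, graded so that each bracket has degree $1$. A quartic is a homogeneous element of degree $4$ in the brackets. $I_x\subset\mathbb{C}[\mathrm{Gr}(r,n)]$ is the ideal of all elements vanishing on $\mathcal{V}_x$,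 and $N_x\subseteq I_x$ is the ideal generated by the brackets $[\lambda]$ with $\lambda$ an $r$-element subset of $\Omega_n$ that is not a basis of $\mathscr{M}_x$. An element of $\mathbb{C}[\mathrm{Gr}(r,n)]$ is nontrivial (for $\mathscr{M}_x$) if it lies in $I_x$ but not in $N_x$. *)

theory Defs
  imports
    "HOL-Algebra.QuotRing"
    "HOL-Library.Poly_Mapping"
    "Jordan_Normal_Form.VS_Connect"
    "Jordan_Normal_Form.DL_Submatrix"
begin

section \<open>Polynomials over the complex numbers\<close>

text \<open>A monomial is a finitely supported exponent function, a polynomial a finitely supported
  coefficient function on monomials.\<close>

type_synonym 'v cpoly = "('v \<Rightarrow>\<^sub>0 nat) \<Rightarrow>\<^sub>0 complex"

definition poly_ring :: "'v set \<Rightarrow> 'v cpoly ring" where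
  "poly_ring V = \<lparr>carrier = {p. \<forall>m\<in>Poly_Mapping.keys p. Poly_Mapping.keys m \<subseteq> V},
     monoid.mult = (*), one = 1, ring.zero = 0, add = (+)\<rparr>"

definition forms :: "'v set \<Rightarrow> nat \<Rightarrow> 'v cpoly set" where
  "forms V k = {p \<in> carrier (poly_ring V). \<forall>m\<in>Poly_Mapping.keys p.
     (\<Sum>v\<in>Poly_Mapping.keys m. Poly_Mapping.lookup m v) = k}"

definition const :: "complex \<Rightarrow> 'v cpoly" where
  "const c = Poly_Mapping.single 0 c"

definition var :: "'v \<Rightarrow> 'v cpoly" where
  "var v = Poly_Mapping.single (Poly_Mapping.single v 1) 1"

definition eval_at :: "('v \<Rightarrow> complex) \<Rightarrow> 'v cpoly \<Rightarrow> complex" where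
  "eval_at a p = (\<Sum>m\<in>Poly_Mapping.keys p. Poly_Mapping.lookup p m *
     (\<Prod>v\<in>Poly_Mapping.keys m. a v ^ Poly_Mapping.lookup m v))"

lemma cring_poly_ring: "cring (poly_ring V)"
proof -
  let ?R = "poly_ring V"
  have ops: "x \<oplus>\<^bsub>?R\<^esub> y = x + y" "x \<otimes>\<^bsub>?R\<^esub> y = x * y" "\<zero>\<^bsub>?R\<^esub> = 0" "\<one>\<^bsub>?R\<^esub> = 1" for x y
    by (simp_all add: poly_ring_def)
  have mem: "p \<in> carrier ?R \<longleftrightarrow> (\<forall>m\<in>Poly_Mapping.keys p. Poly_Mapping.keys m \<subseteq> V)" for p
    by (simp add: poly_ring_def)
  have plus: "p + q \<in> carrier ?R" if "p \<in> carrier ?R" "q \<in> carrier ?R" for p q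
    using that Poly_Mapping.keys_add[of p q] unfolding mem by blast
  have times: "p * q \<in> carrier ?R" if pq: "p \<in> carrier ?R" "q \<in> carrier ?R" for p q
    unfolding mem
  proof
    fix m assume "m \<in> Poly_Mapping.keys (p * q)"
    then obtain a b where "m = a + b" "a \<in> Poly_Mapping.keys p" "b \<in> Poly_Mapping.keys q"
      using keys_mult[of p q] by blast
    then show "Poly_Mapping.keys m \<subseteq> V"
      using pq Poly_Mapping.keys_add[of a b] unfolding mem by blast
  qed
  have inverse: "\<exists>q\<in>carrier ?R. q + p = 0" if "p \<in> carrier ?R" for p
    using that by (intro bexI[of _ "- p"]) (simp_all add: mem)
  have unit: "0 \<in> carrier ?R" "1 \<in> carrier ?R"
    by (simp_all add: mem)
  show ?thesis
    by (intro cringI abelian_groupI comm_monoidI; (unfold ops)?)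
      (fact plus times inverse unit | simp add: algebra_simps)+
qed

section \<open>Linear subspaces and Grassmannians\<close>

text \<open>Indices start at 0, so that the ground set of \<open>n\<close> elements is \<open>{..<n}\<close>.\<close>

abbreviation cspace :: "nat \<Rightarrow> (complex, complex vec) module" where
  "cspace n \<equiv> module_vec TYPE(complex) n"

abbreviation cspan :: "nat \<Rightarrow> complex vec set \<Rightarrow> complex vec set" where
  "cspan n \<equiv> LinearCombinations.module.span class_ring (cspace n)"

abbreviation cindep :: "nat \<Rightarrow> complex vec set \<Rightarrow> bool" where
  "cindep n S \<equiv> \<not> LinearCombinations.module.lin_dep class_ring (cspace n) S"

definition Gr :: "nat \<Rightarrow> nat \<Rightarrow> complex vec set set" where
  "Gr r n = {W. VectorSpace.subspace class_ring W (cspace n) \<and>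
     vectorspace.dim class_ring ((cspace n)\<lparr>carrier := W\<rparr>) = r}"

text \<open>The projective space of dimension \<open>d\<close> is \<open>Gr 1 (d + 1)\<close>. For nonzero \<open>v\<close>, \<open>proj_point n v\<close>
  is its point with homogeneous coordinates \<open>v\<close>, where \<open>n\<close> is the length of \<open>v\<close>.\<close>

definition proj_point :: "nat \<Rightarrow> complex vec \<Rightarrow> complex vec set" where
  "proj_point n v = cspan n {v}"

definition homog_coords :: "nat \<Rightarrow> complex vec \<Rightarrow> complex vec set \<Rightarrow> bool" where
  "homog_coords n v p \<longleftrightarrow> v \<in> carrier_vec n \<and> v \<noteq> 0\<^sub>v n \<and> proj_point n v = p"

definition join :: "nat \<Rightarrow> complex vec set set \<Rightarrow> complex vec set" where
  "join n S = cspan n (\<Union>S)"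

definition represents :: "nat \<Rightarrow> nat \<Rightarrow> complex mat \<Rightarrow> complex vec set \<Rightarrow> bool" where
  "represents r n A x \<longleftrightarrow> A \<in> carrier_mat r n \<and> distinct (rows A) \<and>
     cindep n (set (rows A)) \<and> cspan n (set (rows A)) = x"

section \<open>The homogeneous coordinate ring of the Grassmannian\<close>

definition brackets :: "nat \<Rightarrow> nat \<Rightarrow> nat set set" where
  "brackets r n = {l. l \<subseteq> {..<n} \<and> card l = r}"

text \<open>The bracket of an arbitrary sequence of indices is alternating in its entries; \<open>var (set js)\<close>
  is the bracket of the increasing rearrangement.\<close>

definition bracket :: "nat list \<Rightarrow> nat set cpoly" where
  "bracket js = (if distinct js
     then const ((-1) ^ card {(a, b). a < b \<and> b < length js \<and> js ! a > js ! b}) * var (set js)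
     else 0)"

definition pluecker_relations :: "nat \<Rightarrow> nat \<Rightarrow> nat set cpoly set" where
  "pluecker_relations r n =
     {(\<Sum>k\<le>r. const ((-1) ^ k) * bracket (ks @ [js ! k]) * bracket (take k js @ drop (Suc k) js))
      | ks js. length ks + 1 = r \<and> length js = r + 1 \<and> set ks \<subseteq> {..<n} \<and> set js \<subseteq> {..<n}}"

abbreviation bracket_ring :: "nat \<Rightarrow> nat \<Rightarrow> nat set cpoly ring" where
  "bracket_ring r n \<equiv> poly_ring (brackets r n)"

definition pluecker_ideal :: "nat \<Rightarrow> nat \<Rightarrow> nat set cpoly set" where
  "pluecker_ideal r n = genideal (bracket_ring r n) (pluecker_relations r n)"

definition coord_ring :: "nat \<Rightarrow> nat \<Rightarrow> nat set cpoly set ring" where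
  "coord_ring r n = bracket_ring r n Quot pluecker_ideal r n"

definition residue_class :: "nat \<Rightarrow> nat \<Rightarrow> nat set cpoly \<Rightarrow> nat set cpoly set" where
  "residue_class r n p = a_r_coset (bracket_ring r n) (pluecker_ideal r n) p"

definition homogeneous :: "nat \<Rightarrow> nat \<Rightarrow> nat \<Rightarrow> nat set cpoly set \<Rightarrow> bool" where
  "homogeneous r n k f \<longleftrightarrow> (\<exists>p\<in>forms (brackets r n) k. f = residue_class r n p)"

definition minor :: "complex mat \<Rightarrow> nat set \<Rightarrow> complex" where
  "minor A l = det (submatrix A UNIV l)"

text \<open>Vanishing at \<open>y\<close> means vanishing at all Pluecker coordinate vectors of \<open>y\<close>; which
  representative \<open>p\<close> of \<open>f\<close> is evaluated is immaterial, as the Pluecker relations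
  vanish at all of them.\<close>

definition vanishes_at :: "nat \<Rightarrow> nat \<Rightarrow> nat set cpoly set \<Rightarrow> complex vec set \<Rightarrow> bool" where
  "vanishes_at r n f y \<longleftrightarrow> (\<forall>A p. represents r n A y \<longrightarrow> p \<in> f \<longrightarrow> eval_at (minor A) p = 0)"

definition zero_locus :: "nat \<Rightarrow> nat \<Rightarrow> nat set cpoly set set \<Rightarrow> complex vec set set" where
  "zero_locus r n S = {y \<in> Gr r n. \<forall>f\<in>S. vanishes_at r n f y}"

definition zariski_closed :: "nat \<Rightarrow> nat \<Rightarrow> complex vec set set \<Rightarrow> bool" where
  "zariski_closed r n Z \<longleftrightarrow>
     (\<exists>S. (\<forall>f\<in>S. \<exists>k. homogeneous r n k f) \<and> Z = zero_locus r n S)"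

definition zariski_closure :: "nat \<Rightarrow> nat \<Rightarrow> complex vec set set \<Rightarrow> complex vec set set" where
  "zariski_closure r n Y = \<Inter>{Z. zariski_closed r n Z \<and> Y \<subseteq> Z}"

section \<open>Matroid varieties\<close>

text \<open>The matroid of \<open>x\<close>, given by its set of bases. Injectivity is required because independence
  is a property of sets of vectors, and two columns with different indices may be equal.\<close>

definition matroid_bases :: "nat \<Rightarrow> nat \<Rightarrow> complex vec set \<Rightarrow> nat set set" where
  "matroid_bases r n x = {l \<in> brackets r n. \<exists>A. represents r n A x \<and>
     inj_on (col A) l \<and> cindep r (col A ` l)}"

definition matroid_stratum :: "nat \<Rightarrow> nat \<Rightarrow> complex vec set \<Rightarrow> complex vec set set" where
  "matroid_stratum r n x = {y \<in> Gr r n. matroid_bases r n y = matroid_bases r n x}"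

definition matroid_variety :: "nat \<Rightarrow> nat \<Rightarrow> complex vec set \<Rightarrow> complex vec set set" where
  "matroid_variety r n x = zariski_closure r n (matroid_stratum r n x)"

definition matroid_ideal :: "nat \<Rightarrow> nat \<Rightarrow> complex vec set \<Rightarrow> nat set cpoly set set" where
  "matroid_ideal r n x =
     {f \<in> carrier (coord_ring r n). \<forall>y\<in>matroid_variety r n x. vanishes_at r n f y}"

definition nonbasis_ideal :: "nat \<Rightarrow> nat \<Rightarrow> complex vec set \<Rightarrow> nat set cpoly set set" where
  "nonbasis_ideal r n x = genideal (coord_ring r n)
     ((\<lambda>l. residue_class r n (var l)) ` (brackets r n - matroid_bases r n x))"

definition nontrivial :: "nat \<Rightarrow> nat \<Rightarrow> complex vec set \<Rightarrow> nat set cpoly set \<Rightarrow> bool" where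
  "nontrivial r n x f \<longleftrightarrow> f \<in> matroid_ideal r n x \<and> f \<notin> nonbasis_ideal r n x"

section \<open>Points on a rational normal curve and the Pascal points of their hexagons\<close>

definition forms_basis :: "nat \<Rightarrow> (nat \<Rightarrow> nat cpoly) \<Rightarrow> bool" where
  "forms_basis d F \<longleftrightarrow> (\<forall>i\<le>d. F i \<in> forms {0, 1} d) \<and>
     (\<forall>c. (\<Sum>i\<le>d. const (c i) * F i) = 0 \<longrightarrow> (\<forall>i\<le>d. c i = 0)) \<and>
     (\<forall>G\<in>forms {0, 1} d. \<exists>c. G = (\<Sum>i\<le>d. const (c i) * F i))"

definition rational_normal_curve :: "nat \<Rightarrow> complex vec set set \<Rightarrow> bool" where
  "rational_normal_curve d C \<longleftrightarrow> (\<exists>F. forms_basis d F \<and>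
     C = {proj_point (d + 1) (vec (d + 1) (\<lambda>i. eval_at a (F i))) | a. a 0 \<noteq> 0 \<or> a 1 \<noteq> 0})"

text \<open>\<open>pick l k\<close> is the element of \<open>l\<close> at position \<open>k\<close> in increasing order, counted from 0. The
  intersection of a line and a hyperplane that meet in one point of projective space is that
  point, as a one-dimensional linear subspace.\<close>

definition cs_points :: "nat \<Rightarrow> (nat \<Rightarrow> complex vec set) \<Rightarrow> complex vec set set" where
  "cs_points d P = (\<Union>l\<in>brackets 6 (d + 4).
     let p = (\<lambda>k. P (pick l k)); H = P ` ({..<d + 4} - l) in
     {join (d + 1) {p 0, p 1} \<inter> join (d + 1) ({p 3, p 4} \<union> H),
      join (d + 1) {p 1, p 2} \<inter> join (d + 1) ({p 4, p 5} \<union> H),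
      join (d + 1) {p 2, p 3} \<inter> join (d + 1) ({p 5, p 0} \<union> H)})"

end

theory Submission
  imports Defs "Jordan_Normal_Form.DL_Rank" "HOL-Computational_Algebra.Fundamental_Theorem_Algebra"
begin

text \<open>The quartic is the condition that six points lie on a conic. Take the hexagon of the first six
  points \<open>P\<^sub>0, \<dots>, P\<^sub>5\<close> and let \<open>H\<close> be the span of the others. Writing \<open>[ijk]\<close> for the
  bracket of \<open>i, j, k\<close> and the indices of the points in \<open>H\<close>, that is, for the bracket of three points
  of the plane to which \<open>H\<close> projects, the quartic is
  \<open>[012][034][135][245] - [013][024][125][345]\<close>.

  Every element of the stratum of \<open>x\<close> is represented by a matrix whose column brackets vanish
  exactly where those of \<open>A\<close> do (\<open>col_det_zero_iff_of_same_matroid\<close>). The three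
  Pascal points of the hexagon are columns of \<open>A\<close>, and that each lies on a side of the hexagon and
  in the span of the opposite side and \<open>H\<close> is a statement about vanishing brackets. Under these
  incidences the bracket of the three Pascal points is a nonzero multiple of the quartic: this is
  Pascal's theorem together with its converse (\<open>pascal_iff_conic\<close>). For \<open>A\<close>, the points on a
  rational normal curve have Vandermonde brackets (\<open>col_det_rational_normal_curve\<close>), so the two
  products in the quartic are equal, and the three Pascal points are
  collinear modulo \<open>H\<close>. Since this is again the vanishing of a bracket, it holds on the whole
  stratum, and there the converse gives the vanishing of the quartic. The zero locus of the quartic
  is closed, so the quartic vanishes on the matroid variety (\<open>residue_class_in_matroid_ideal\<close>).

  For the nontriviality, the Vandermonde brackets also show that every \<open>d + 1\<close> of the points
  \<open>P\<^sub>j\<close> are independent, so that each nonbasis of \<open>x\<close> contains the index of a point of \<open>\<Q>\<close>.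
  A matrix whose columns at \<open>\<Q>\<close> are zero therefore kills all the generators of
  \<open>nonbasis_ideal\<close>, hence the ideal, whereas its first six columns can be chosen off the conic
  (\<open>conic_quartic_witness\<close>, \<open>notin_nonbasis_ideal\<close>).\<close>

section \<open>Evaluation of polynomials\<close>

definition monomial_at :: "('v \<Rightarrow> complex) \<Rightarrow> ('v \<Rightarrow>\<^sub>0 nat) \<Rightarrow> complex" where
  "monomial_at a m = (\<Prod>v\<in>Poly_Mapping.keys m. a v ^ Poly_Mapping.lookup m v)"

lemma monomial_at_superset:
  assumes "finite S" "Poly_Mapping.keys m \<subseteq> S"
  shows "monomial_at a m = (\<Prod>v\<in>S. a v ^ Poly_Mapping.lookup m v)"
  unfolding monomial_at_def
  by (rule prod.mono_neutral_left) (use assms in \<open>auto simp: in_keys_iff\<close>)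

lemma monomial_at_add: "monomial_at a (m + m') = monomial_at a m * monomial_at a m'"
proof -
  let ?S = "Poly_Mapping.keys m \<union> Poly_Mapping.keys m'"
  have "monomial_at a (m + m') = (\<Prod>v\<in>?S. a v ^ Poly_Mapping.lookup (m + m') v)"
    by (rule monomial_at_superset) (use Poly_Mapping.keys_add[of m m'] in auto)
  also have "\<dots> = (\<Prod>v\<in>?S. a v ^ Poly_Mapping.lookup m v) * (\<Prod>v\<in>?S. a v ^ Poly_Mapping.lookup m' v)"
    by (simp add: lookup_add power_add prod.distrib)
  also have "\<dots> = monomial_at a m * monomial_at a m'"
    by (simp add: monomial_at_superset[of ?S])
  finally show ?thesis .
qed

lemma eval_at_superset:
  assumes "finite S" "Poly_Mapping.keys p \<subseteq> S"
  shows "eval_at a p = (\<Sum>m\<in>S. Poly_Mapping.lookup p m * monomial_at a m)"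
  unfolding eval_at_def monomial_at_def
  by (rule sum.mono_neutral_left) (use assms in \<open>auto simp: in_keys_iff\<close>)

lemma eval_at_add: "eval_at a (p + q) = eval_at a p + eval_at a q"
proof -
  let ?S = "Poly_Mapping.keys p \<union> Poly_Mapping.keys q"
  have "eval_at a (p + q) = (\<Sum>m\<in>?S. Poly_Mapping.lookup (p + q) m * monomial_at a m)"
    by (rule eval_at_superset) (use Poly_Mapping.keys_add[of p q] in auto)
  then show ?thesis
    by (simp add: eval_at_superset[of ?S] lookup_add distrib_right sum.distrib)
qed

lemma eval_at_zero [simp]: "eval_at a 0 = 0"
  by (simp add: eval_at_def)

lemma eval_at_uminus: "eval_at a (- p) = - eval_at a p"
  using eval_at_add[of a p "- p"] by (simp add: add_eq_0_iff)

lemma eval_at_diff: "eval_at a (p - q) = eval_at a p - eval_at a q"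
  using eval_at_add[of a p "- q"] by (simp add: eval_at_uminus)

lemma eval_at_sum: "eval_at a (sum p S) = (\<Sum>s\<in>S. eval_at a (p s))"
  by (induction S rule: infinite_finite_induct) (auto simp: eval_at_add)

lemma eval_at_single: "eval_at a (Poly_Mapping.single m c) = c * monomial_at a m"
  by (subst eval_at_superset[of "{m}"]) auto

lemma poly_as_sum_of_monomials:
  fixes p :: "'v cpoly"
  shows "p = (\<Sum>m\<in>Poly_Mapping.keys p. Poly_Mapping.single m (Poly_Mapping.lookup p m))"
  by (rule poly_mapping_eqI)
    (auto simp: lookup_sum lookup_single when_def in_keys_iff sum.delta)

lemma eval_at_mult: "eval_at a (p * q) = eval_at a p * eval_at a q"
proof -
  let ?t = "\<lambda>p m. Poly_Mapping.single m (Poly_Mapping.lookup p m)"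
  have "p * q = (\<Sum>m\<in>Poly_Mapping.keys p. \<Sum>m'\<in>Poly_Mapping.keys q. ?t p m * ?t q m')"
    by (subst poly_as_sum_of_monomials[of p], subst poly_as_sum_of_monomials[of q])
      (simp add: sum_product)
  then have "eval_at a (p * q) =
      (\<Sum>m\<in>Poly_Mapping.keys p. \<Sum>m'\<in>Poly_Mapping.keys q.
        (Poly_Mapping.lookup p m * monomial_at a m) * (Poly_Mapping.lookup q m' * monomial_at a m'))"
    by (simp add: eval_at_sum mult_single eval_at_single monomial_at_add mult_ac)
  then show ?thesis
    by (simp only: eval_at_superset[OF finite_keys order_refl] sum_product)
qed

lemma eval_at_const [simp]: "eval_at a (const c) = c"
  by (simp add: const_def eval_at_single monomial_at_def)

lemma eval_at_var [simp]: "eval_at a (var v) = a v"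
  by (simp add: var_def eval_at_single monomial_at_def)

lemma lookup_const_mult: "Poly_Mapping.lookup (const c * p) m = c * Poly_Mapping.lookup p m"
proof -
  have "const c * p = (\<Sum>m\<in>Poly_Mapping.keys p. Poly_Mapping.single m (c * Poly_Mapping.lookup p m))"
    by (subst poly_as_sum_of_monomials[of p]) (simp add: const_def sum_distrib_left mult_single)
  then show ?thesis
    by (auto simp: lookup_sum lookup_single when_def in_keys_iff sum.delta)
qed

lemma const_in_poly_ring: "const c \<in> carrier (poly_ring V)"
  by (auto simp: const_def poly_ring_def)

lemma var_in_poly_ring: "v \<in> V \<Longrightarrow> var v \<in> carrier (poly_ring V)"
  by (auto simp: var_def poly_ring_def)

lemma poly_ring_closed:
  assumes "p \<in> carrier (poly_ring V)" "q \<in> carrier (poly_ring V)"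
  shows "p * q \<in> carrier (poly_ring V)" and "p + q \<in> carrier (poly_ring V)"
proof -
  interpret cring "poly_ring V" by (rule cring_poly_ring)
  show "p * q \<in> carrier (poly_ring V)" "p + q \<in> carrier (poly_ring V)"
    using m_closed[OF assms] a_closed[OF assms] by (simp_all add: poly_ring_def)
qed

lemma poly_ring_sum_closed:
  "(\<And>s. s \<in> S \<Longrightarrow> p s \<in> carrier (poly_ring V)) \<Longrightarrow> sum p S \<in> carrier (poly_ring V)"
  by (induction S rule: infinite_finite_induct)
    (auto intro: poly_ring_closed, auto simp: poly_ring_def)

definition monomial_degree :: "('v \<Rightarrow>\<^sub>0 nat) \<Rightarrow> nat" where
  "monomial_degree m = (\<Sum>v\<in>Poly_Mapping.keys m. Poly_Mapping.lookup m v)"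

lemma monomial_degree_add: "monomial_degree (m + m') = monomial_degree m + monomial_degree m'"
proof -
  let ?S = "Poly_Mapping.keys m \<union> Poly_Mapping.keys m'"
  have super: "monomial_degree k = (\<Sum>v\<in>?S. Poly_Mapping.lookup k v)" if "Poly_Mapping.keys k \<subseteq> ?S" for k
    unfolding monomial_degree_def
    by (rule sum.mono_neutral_left) (use that in \<open>auto simp: in_keys_iff\<close>)
  show ?thesis
    using Poly_Mapping.keys_add[of m m'] by (simp add: super lookup_add sum.distrib)
qed

lemma forms_iff: "p \<in> forms V k \<longleftrightarrow> p \<in> carrier (poly_ring V) \<and> (\<forall>m\<in>Poly_Mapping.keys p. monomial_degree m = k)"
  by (simp add: forms_def monomial_degree_def)

lemma forms_mult:
  assumes "p \<in> forms V k" "q \<in> forms V l"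
  shows "p * q \<in> forms V (k + l)"
  using assms keys_mult[of p q] poly_ring_closed(1)[of p V q]
  by (fastforce simp: forms_iff monomial_degree_add)

lemma forms_diff:
  assumes "p \<in> forms V k" "q \<in> forms V k"
  shows "p - q \<in> forms V k"
proof -
  have "Poly_Mapping.keys (p - q) \<subseteq> Poly_Mapping.keys p \<union> Poly_Mapping.keys q"
    by (auto simp: in_keys_iff lookup_minus)
  with assms show ?thesis by (fastforce simp: forms_def poly_ring_def)
qed

section \<open>The coordinate ring and its points\<close>

lemma ideal_vanishing_at: "ideal {p \<in> carrier (poly_ring V). eval_at a p = 0} (poly_ring V)"
    (is "ideal ?K ?R")
proof -
  interpret R: cring ?R by (rule cring_poly_ring)
  have ops: "x \<oplus>\<^bsub>?R\<^esub> y = x + y" "x \<otimes>\<^bsub>?R\<^esub> y = x * y" "\<zero>\<^bsub>?R\<^esub> = 0" for x y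
    by (simp_all add: poly_ring_def)
  have neg: "eval_at a (\<ominus>\<^bsub>?R\<^esub> p) = 0" if "p \<in> ?K" for p
  proof -
    from that have "p \<oplus>\<^bsub>?R\<^esub> \<ominus>\<^bsub>?R\<^esub> p = \<zero>\<^bsub>?R\<^esub>"
      by (intro R.r_neg) auto
    then have "eval_at a (p + \<ominus>\<^bsub>?R\<^esub> p) = 0"
      by (simp add: ops)
    with that show ?thesis
      by (simp add: eval_at_add)
  qed
  show ?thesis
  proof (rule idealI)
    show "subgroup ?K (add_monoid ?R)"
    proof (rule R.add.subgroupI)
      show "?K \<noteq> {}" using R.zero_closed by (force simp: ops)
    qed (use neg R.a_inv_closed R.a_closed in \<open>auto simp: ops eval_at_add simp flip: a_inv_def\<close>)
  qed (use R.ring_axioms R.m_closed in \<open>auto simp: ops eval_at_mult\<close>)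
qed

lemma bracket_in_bracket_ring:
  assumes "length js = r" "set js \<subseteq> {..<n}"
  shows "bracket js \<in> carrier (bracket_ring r n)"
proof (cases "distinct js")
  case True
  then show ?thesis
    using assms
    by (auto simp: bracket_def brackets_def distinct_card
        intro!: poly_ring_closed const_in_poly_ring var_in_poly_ring)
qed (simp add: bracket_def poly_ring_def)

lemma bracket_in_forms:
  assumes "length js = r" "set js \<subseteq> {..<n}"
  shows "bracket js \<in> forms (brackets r n) 1"
proof -
  have "Poly_Mapping.keys (bracket js) \<subseteq> {Poly_Mapping.single (set js) 1}"
    by (auto simp: bracket_def const_def var_def mult_single split: if_splits)
  then show ?thesis
    using bracket_in_bracket_ring[OF assms] by (auto simp: forms_iff monomial_degree_def)
qed

lemma pluecker_relations_in_bracket_ring: "pluecker_relations r n \<subseteq> carrier (bracket_ring r n)"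
proof
  fix p assume "p \<in> pluecker_relations r n"
  then obtain ks js where p: "p = (\<Sum>k\<le>r. const ((-1) ^ k) * bracket (ks @ [js ! k])
        * bracket (take k js @ drop (Suc k) js))"
    and len: "length ks + 1 = r" "length js = r + 1" and sub: "set ks \<subseteq> {..<n}" "set js \<subseteq> {..<n}"
    unfolding pluecker_relations_def by blast
  have nth: "js ! k < n" if "k \<le> r" for k
    using that len sub(2) subsetD[OF sub(2) nth_mem, of k] by simp
  have rest: "set (take k js @ drop (Suc k) js) \<subseteq> {..<n}" for k
    using sub by (auto dest: in_set_takeD in_set_dropD)
  show "p \<in> carrier (bracket_ring r n)"
    unfolding p using len nth rest sub
    by (intro poly_ring_sum_closed poly_ring_closed const_in_poly_ring bracket_in_bracket_ring) auto
qed

lemma ideal_pluecker: "ideal (pluecker_ideal r n) (bracket_ring r n)"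
  unfolding pluecker_ideal_def
  by (rule ring.genideal_ideal)
    (use cring_poly_ring pluecker_relations_in_bracket_ring in \<open>auto simp: cring_def\<close>)

lemma residue_class_in_coord_ring:
  "p \<in> carrier (bracket_ring r n) \<Longrightarrow> residue_class r n p \<in> carrier (coord_ring r n)"
  by (auto simp: coord_ring_def FactRing_def residue_class_def A_RCOSETS_def')

text \<open>Values \<open>a\<close> of the brackets that satisfy the Pluecker relations: a point of the affine cone
  over the Grassmannian. Evaluation at it is well defined on the coordinate ring, so that it can
  separate a residue class from an ideal.\<close>

locale pluecker_point =
  fixes r n :: nat and a :: "nat set \<Rightarrow> complex"
  assumes pluecker_relation: "p \<in> pluecker_relations r n \<Longrightarrow> eval_at a p = 0"
begin

lemma eval_pluecker: "eval_at a p = 0" if "p \<in> pluecker_ideal r n"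
proof -
  have "pluecker_ideal r n \<subseteq> {p \<in> carrier (bracket_ring r n). eval_at a p = 0}"
    unfolding pluecker_ideal_def
    by (rule ring.genideal_minimal[OF _ ideal_vanishing_at])
      (use cring_poly_ring pluecker_relations_in_bracket_ring pluecker_relation in \<open>auto simp: cring_def\<close>)
  then show ?thesis using that by auto
qed

lemma eval_residue: "eval_at a q = eval_at a p" if "q \<in> residue_class r n p"
  using that eval_pluecker
  by (auto simp: residue_class_def a_r_coset_def' poly_ring_def eval_at_add)

text \<open>The polynomials that vanish at the point form an ideal; its image in the coordinate ring contains the
  generators of \<open>nonbasis_ideal\<close>, hence all of it.\<close>

lemma notin_nonbasis_ideal:
  assumes vanish: "\<And>l. l \<in> brackets r n - matroid_bases r n x \<Longrightarrow> a l = 0"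
    and p: "p \<in> carrier (bracket_ring r n)" "eval_at a p \<noteq> 0"
  shows "residue_class r n p \<notin> nonbasis_ideal r n x"
proof
  let ?R = "bracket_ring r n" and ?I = "pluecker_ideal r n"
  let ?K = "{p \<in> carrier ?R. eval_at a p = 0}"
  interpret R: cring ?R by (rule cring_poly_ring)
  interpret I: ideal ?I ?R by (rule ideal_pluecker)
  have J: "ideal (residue_class r n ` ?K) (coord_ring r n)"
    using R.ring_ideal_imp_quot_ideal[OF ideal_pluecker ideal_vanishing_at[of "brackets r n" a]]
    by (simp add: residue_class_def coord_ring_def)
  have vars: "var l \<in> ?K" if "l \<in> brackets r n - matroid_bases r n x" for l
    using that vanish by (auto simp: poly_ring_def) (auto simp: var_def)
  have "nonbasis_ideal r n x \<subseteq> residue_class r n ` ?K"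
    unfolding nonbasis_ideal_def
    by (rule ring.genideal_minimal[OF _ J])
      (use I.quotient_is_ring vars in \<open>auto simp: coord_ring_def\<close>)
  moreover assume "residue_class r n p \<in> nonbasis_ideal r n x"
  ultimately obtain q where q: "q \<in> ?K" "residue_class r n p = residue_class r n q"
    by auto
  have "p \<in> residue_class r n p"
    using I.a_rcos_self[OF p(1)] by (simp add: residue_class_def)
  with q have "eval_at a p = eval_at a q"
    by (simp add: eval_residue)
  with q p show False by simp
qed

end

section \<open>Determinants of lists of columns\<close>

text \<open>The columns come as a list, so that a column may be repeated or replaced by an arbitrary vector.
  The matrix is square if the vectors have as many entries as the list.\<close>

definition col_det :: "complex vec list \<Rightarrow> complex" where
  "col_det vs = det (mat_of_cols (length vs) vs)"

text \<open>Laplace expansion along the column \<open>v\<close>: the cofactors do not depend on \<open>v\<close>. The functional \<open>w\<close>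
  makes multilinearity, and the vanishing on a span, available in any one column.\<close>

lemma col_det_linear:
  assumes "r = Suc (length us + length vs)"
  obtains w where "w \<in> carrier_vec r"
    "\<And>v. v \<in> carrier_vec r \<Longrightarrow> col_det (us @ v # vs) = w \<bullet> v"
proof
  let ?M = "\<lambda>v. mat_of_cols r (us @ v # vs)"
  define w where "w = vec r (\<lambda>i. cofactor (?M (0\<^sub>v r)) i (length us))"
  show "w \<in> carrier_vec r"
    by (simp add: w_def)
  fix v :: "complex vec" assume v: "v \<in> carrier_vec r"
  have M: "?M v \<in> carrier_mat r r"
    using assms by (auto simp: mat_of_cols_def)
  have "mat_delete (?M v) i (length us) = mat_delete (?M (0\<^sub>v r)) i (length us)" for i
    using assms by (intro eq_matI) (auto simp: mat_delete_def mat_of_cols_index nth_append)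
  then have "cofactor (?M v) i (length us) = cofactor (?M (0\<^sub>v r)) i (length us)" for i
    by (simp add: cofactor_def)
  then have "det (?M v) = (\<Sum>i<r. v $ i * cofactor (?M (0\<^sub>v r)) i (length us))"
    using assms by (subst laplace_expansion_column[OF M, of "length us"])
      (auto simp: mat_of_cols_index nth_append intro!: sum.cong)
  also have "\<dots> = w \<bullet> v"
    using v by (auto simp: scalar_prod_def w_def mult.commute lessThan_atLeast0 intro!: sum.cong)
  finally show "col_det (us @ v # vs) = w \<bullet> v"
    using assms by (simp add: col_det_def)
qed

lemma col_det_not_distinct:
  assumes "\<not> distinct vs"
  shows "col_det vs = 0"
proof -
  obtain i j where ij: "i < length vs" "j < length vs" "i \<noteq> j" "vs ! i = vs ! j"
    using assms by (auto simp: distinct_conv_nth)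
  show ?thesis
    unfolding col_det_def
    by (rule det_identical_columns[OF _ ij(3,1,2)]) (use ij in \<open>auto simp: mat_of_cols_def\<close>)
qed

lemma col_det_swap: "col_det (us @ v # w # vs) = - col_det (us @ w # v # vs)"
proof -
  let ?n = "Suc (Suc (length us + length vs))"
  let ?M = "mat_of_cols ?n (us @ w # v # vs)"
  have "mat_of_cols ?n (us @ v # w # vs) = swapcols (length us) (Suc (length us)) ?M"
    by (rule eq_matI) (auto simp: mat_of_cols_index nth_append nth_Cons split: nat.splits)
  moreover have "det (swapcols (length us) (Suc (length us)) ?M) = - det ?M"
    by (rule det_swapcols[of _ ?n]) (auto simp: mat_of_cols_def)
  ultimately show ?thesis
    by (simp add: col_det_def)
qed

text \<open>As the first factor is linear in \<open>xs ! k\<close>, it suffices that the combination of the vectors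
  \<open>xs ! k\<close> with the signed complementary determinants as coefficients is zero. Its entry \<open>i\<close> is the
  Laplace expansion, along the first row, of a matrix in which the row of the entries \<open>i\<close> occurs twice.\<close>

lemma col_det_grassmann_pluecker:
  assumes us: "Suc (length us) = r" and xs: "length xs = Suc r"
    and carrier: "set us \<subseteq> carrier_vec r" "set xs \<subseteq> carrier_vec r"
  shows "(\<Sum>k\<le>r. (-1) ^ k * col_det (us @ [xs ! k]) * col_det (take k xs @ drop (Suc k) xs)) = 0"
proof -
  obtain w where w: "w \<in> carrier_vec r" "\<And>v. v \<in> carrier_vec r \<Longrightarrow> col_det (us @ [v]) = w \<bullet> v"
    using col_det_linear[of r us "[]"] us by auto
  let ?x = "\<lambda>k. col_det (take k xs @ drop (Suc k) xs)"
  have row: "(\<Sum>k\<le>r. (-1) ^ k * xs ! k $ i * ?x k) = 0" if i: "i < r" for i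
  proof -
    (* row 0 repeats row i of the matrix of all r + 1 columns *)
    define N where "N = mat (Suc r) (Suc r) (\<lambda>(a, k). if a = 0 then xs ! k $ i else xs ! k $ (a - 1))"
    have N: "N \<in> carrier_mat (Suc r) (Suc r)"
      by (simp add: N_def)
    have "mat_delete N 0 k = mat_of_cols r (take k xs @ drop (Suc k) xs)" if "k \<le> r" for k
      using that xs by (intro eq_matI) (auto simp: N_def mat_delete_def mat_of_cols_index nth_append min_def)
    then have "cofactor N 0 k = (-1) ^ k * ?x k" if "k \<le> r" for k
      using that xs by (simp add: cofactor_def col_det_def)
    then have "det N = (\<Sum>k<Suc r. xs ! k $ i * ((-1) ^ k * ?x k))"
      by (subst laplace_expansion_row[OF N, of 0]) (auto simp: N_def intro!: sum.cong)
    also have "\<dots> = (\<Sum>k\<le>r. (-1) ^ k * xs ! k $ i * ?x k)"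
      by (simp add: lessThan_Suc_atMost mult_ac)
    moreover have "det N = 0"
      by (rule det_identical_rows[OF N, of 0 "Suc i"])
        (use i in \<open>auto simp: N_def intro!: eq_vecI\<close>)
    ultimately show ?thesis by simp
  qed
  have "(\<Sum>k\<le>r. (-1) ^ k * col_det (us @ [xs ! k]) * ?x k)
      = (\<Sum>k\<le>r. (-1) ^ k * (\<Sum>i<r. w $ i * xs ! k $ i) * ?x k)"
  proof (rule sum.cong[OF refl])
    fix k assume "k \<in> {..r}"
    then have "xs ! k \<in> carrier_vec r"
      using carrier(2) xs nth_mem[of k xs] by auto
    then show "(-1) ^ k * col_det (us @ [xs ! k]) * ?x k = (-1) ^ k * (\<Sum>i<r. w $ i * xs ! k $ i) * ?x k"
      by (simp add: w(2)) (simp add: scalar_prod_def lessThan_atLeast0)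
  qed
  also have "\<dots> = (\<Sum>k\<le>r. \<Sum>i<r. w $ i * ((-1) ^ k * xs ! k $ i * ?x k))"
    by (simp add: sum_distrib_left sum_distrib_right mult_ac)
  also have "\<dots> = (\<Sum>i<r. w $ i * (\<Sum>k\<le>r. (-1) ^ k * xs ! k $ i * ?x k))"
    by (subst sum.swap) (simp add: sum_distrib_left)
  also have "\<dots> = 0"
    using row by simp
  finally show ?thesis .
qed

section \<open>Signs of brackets\<close>

definition inversions :: "nat list \<Rightarrow> nat" where
  "inversions js = card {(a, b). a < b \<and> b < length js \<and> js ! a > js ! b}"

lemma inversions_Nil: "inversions [] = 0"
  by (simp add: inversions_def)

lemma inversions_Cons: "inversions (x # xs) = length (filter (\<lambda>y. y < x) xs) + inversions xs"
proof -
  let ?A = "{b. b < length xs \<and> xs ! b < x}"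
  let ?B = "{(a, b). a < b \<and> b < length xs \<and> xs ! a > xs ! b}"
  have fin: "finite ?B"
    by (rule finite_subset[of _ "{..<length xs} \<times> {..<length xs}"]) auto
  have "{(a, b). a < b \<and> b < length (x # xs) \<and> (x # xs) ! a > (x # xs) ! b}
      = (\<lambda>b. (0::nat, Suc b)) ` ?A \<union> map_prod Suc Suc ` ?B" (is "?L = ?R")
  proof (rule Set.set_eqI)
    fix p :: "nat \<times> nat"
    obtain a b where p: "p = (a, b)" by (cases p)
    have "(a, b) \<in> (\<lambda>b. (0, Suc b)) ` S \<longleftrightarrow> a = 0 \<and> (\<exists>k. b = Suc k \<and> k \<in> S)" for S
      by blast
    moreover have "(a, b) \<in> map_prod Suc Suc ` S \<longleftrightarrow> (\<exists>i k. a = Suc i \<and> b = Suc k \<and> (i, k) \<in> S)" for S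
      by force
    ultimately show "p \<in> ?L \<longleftrightarrow> p \<in> ?R"
      unfolding p by (cases a; cases b) simp_all
  qed
  then have "inversions (x # xs) = card ((\<lambda>b. (0::nat, Suc b)) ` ?A \<union> map_prod Suc Suc ` ?B)"
    by (simp only: inversions_def)
  also have "\<dots> = card ((\<lambda>b. (0::nat, Suc b)) ` ?A) + card (map_prod Suc Suc ` ?B)"
    by (rule card_Un_disjoint) (use fin in auto)
  also have "\<dots> = card ?A + card ?B"
    by (subst (1 2) card_image) (auto simp: inj_on_def)
  finally show ?thesis
    by (simp add: inversions_def length_filter_conv_card)
qed

text \<open>Moving \<open>x\<close> to its place in a sorted list takes one transposition for each smaller entry. These
  numbers add up to the number of inversions, so that sorting the indices produces the sign that
  \<open>bracket\<close> carries.\<close>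

lemma alternating_insort:
  fixes D :: "nat list \<Rightarrow> complex"
  assumes swap: "\<And>us x y vs. D (us @ x # y # vs) = - D (us @ y # x # vs)"
    and "sorted ys"
  shows "D (us @ x # ys) = (-1) ^ length (filter (\<lambda>y. y < x) ys) * D (us @ insort x ys)"
  using assms(2)
proof (induction ys arbitrary: us)
  case (Cons y ys)
  show ?case
  proof (cases "x \<le> y")
    case True
    then have "filter (\<lambda>y. y < x) (y # ys) = []"
      using Cons.prems by (fastforce simp: filter_empty_conv)
    with True show ?thesis by simp
  next
    case False
    then show ?thesis
      using Cons.IH[of "us @ [y]"] Cons.prems swap[of us x y ys] by simp
  qed
qed simp

lemma alternating_sort:
  fixes D :: "nat list \<Rightarrow> complex"
  assumes swap: "\<And>us x y vs. D (us @ x # y # vs) = - D (us @ y # x # vs)"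
  shows "D (us @ xs) = (-1) ^ inversions xs * D (us @ sort xs)"
proof (induction xs arbitrary: us)
  case (Cons x xs)
  have "D (us @ x # xs) = (-1) ^ inversions xs * D (us @ x # sort xs)"
    using Cons.IH[of "us @ [x]"] by simp
  also have "D (us @ x # sort xs)
      = (-1) ^ length (filter (\<lambda>y. y < x) xs) * D (us @ insort x (sort xs))"
    by (subst alternating_insort[of D, OF swap]) (auto simp: filter_sort)
  finally show ?case
    by (simp add: inversions_Cons power_add)
qed (simp add: inversions_Nil)

text \<open>The columns of \<open>submatrix\<close> are enumerated by \<open>pick\<close>.\<close>

lemma map_pick_eq_sorted_list_of_set:
  assumes "finite l"
  shows "map (pick l) [0..<card l] = sorted_list_of_set l"
proof (rule sorted_distinct_set_unique)
  have mono: "pick l i < pick l j" if "i < j" "j < card l" for i j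
    using that pick_mono_le by blast
  then show "sorted (map (pick l) [0..<card l])"
    by (auto simp: sorted_iff_nth_mono_less intro: less_imp_le)
  have inj: "inj_on (pick l) {0..<card l}"
    by (rule linorder_inj_onI) (use mono in \<open>fastforce+\<close>)
  then show "distinct (map (pick l) [0..<card l])"
    by (simp add: distinct_map)
  have "pick l ` {0..<card l} = l"
    by (rule card_subset_eq) (use assms inj pick_in_set_le in \<open>auto simp: card_image\<close>)
  then show "set (map (pick l) [0..<card l]) = set (sorted_list_of_set l)"
    using assms by simp
qed simp_all

lemma minor_eq_col_det:
  assumes A: "A \<in> carrier_mat r n" and l: "l \<in> brackets r n"
  shows "minor A l = col_det (map (col A) (sorted_list_of_set l))"
proof -
  from l have fin: "finite l" and lr: "card l = r" and sub: "l \<subseteq> {..<n}"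
    by (auto simp: brackets_def intro: finite_subset)
  have "{j. j < dim_col A \<and> j \<in> l} = l"
    using A sub by auto
  with A lr have rows: "card {i. i < dim_row A \<and> i \<in> UNIV} = r"
    and cols: "card {j. j < dim_col A \<and> j \<in> l} = r"
    by simp_all
  have lt: "pick l j < n" if "j < r" for j
    using that pick_in_set_le[of j l] lr sub by auto
  have "submatrix A UNIV l = mat_of_cols r (map (col A) (map (pick l) [0..<card l]))"
    by (rule eq_matI)
      (use A lr lt in \<open>auto simp: submatrix_def rows cols mat_of_cols_index pick_UNIV\<close>)
  then show ?thesis
    by (simp only: minor_def col_det_def map_pick_eq_sorted_list_of_set[OF fin]) (simp add: lr)
qed

lemma col_det_eq_minor:
  assumes A: "A \<in> carrier_mat r n" and js: "length js = r" "distinct js" "set js \<subseteq> {..<n}"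
  shows "col_det (map (col A) js) = (-1) ^ inversions js * minor A (set js)"
proof -
  have "col_det (map (col A) (us @ a # b # vs)) = - col_det (map (col A) (us @ b # a # vs))" for us a b vs
    unfolding map_append list.map by (rule col_det_swap)
  from alternating_sort[of "\<lambda>js. col_det (map (col A) js)", OF this, of "[]" js]
  have "col_det (map (col A) js) = (-1) ^ inversions js * col_det (map (col A) (sort js))"
    unfolding append_Nil .
  moreover have "set js \<in> brackets r n"
    using js by (auto simp: brackets_def distinct_card)
  moreover have "sort js = sorted_list_of_set (set js)"
    using js(2) by (simp add: sorted_list_of_set_sort_remdups distinct_remdups_id)
  ultimately show ?thesis
    using minor_eq_col_det[OF A] by simp
qed

lemma brackets_sorted_list:
  assumes "l \<in> brackets r n"
  shows "finite l" "length (sorted_list_of_set l) = r" "set (sorted_list_of_set l) = l" "l \<subseteq> {..<n}"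
proof -
  from assms show "finite l" by (auto simp: brackets_def intro: finite_subset)
  with assms show "length (sorted_list_of_set l) = r" "set (sorted_list_of_set l) = l" "l \<subseteq> {..<n}"
    by (auto simp: brackets_def)
qed

lemma eval_at_bracket:
  assumes A: "A \<in> carrier_mat r n" and js: "length js = r" "set js \<subseteq> {..<n}"
  shows "eval_at (minor A) (bracket js) = col_det (map (col A) js)"
proof (cases "distinct js")
  case True
  then show ?thesis
    using col_det_eq_minor[OF A js(1) True js(2)]
    by (simp add: bracket_def inversions_def eval_at_mult)
next
  case False
  then show ?thesis
    by (simp add: bracket_def col_det_not_distinct distinct_map)
qed

text \<open>The sign in \<open>bracket\<close> makes the value of a bracket the determinant of its columns in the listed
  order, so that the relations become \<open>col_det_grassmann_pluecker\<close>.\<close>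

lemma pluecker_point_minor:
  assumes A: "A \<in> carrier_mat r n"
  shows "pluecker_point r n (minor A)"
proof
  fix p assume "p \<in> pluecker_relations r n"
  then obtain ks js where p: "p = (\<Sum>k\<le>r. const ((-1) ^ k) * bracket (ks @ [js ! k])
        * bracket (take k js @ drop (Suc k) js))"
    and len: "length ks + 1 = r" "length js = r + 1" and sub: "set ks \<subseteq> {..<n}" "set js \<subseteq> {..<n}"
    unfolding pluecker_relations_def by blast
  have nth: "js ! k < n" if "k \<le> r" for k
    using that len sub(2) subsetD[OF sub(2) nth_mem, of k] by simp
  have rest: "set (take k js @ drop (Suc k) js) \<subseteq> {..<n}" for k
    using sub by (auto dest: in_set_takeD in_set_dropD)
  have "col A j \<in> carrier_vec r" for j
    using A by auto
  moreover have "eval_at (minor A) p = (\<Sum>k\<le>r. (-1) ^ k * col_det (map (col A) ks @ [map (col A) js ! k])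
      * col_det (take k (map (col A) js) @ drop (Suc k) (map (col A) js)))"
    unfolding p eval_at_sum eval_at_mult eval_at_const
    by (intro sum.cong refl, subst (1 2) eval_at_bracket[OF A])
      (use len nth rest sub in \<open>auto simp: take_map drop_map\<close>)
  moreover have "\<dots> = 0"
    by (rule col_det_grassmann_pluecker) (use len calculation in auto)
  ultimately show "eval_at (minor A) p = 0" by simp
qed

section \<open>Matroids and minors\<close>

lemma col_det_mult:
  assumes M: "M \<in> carrier_mat r r" and A: "A \<in> carrier_mat r n" and js: "length js = r" "set js \<subseteq> {..<n}"
  shows "col_det (map (col (M * A)) js) = det M * col_det (map (col A) js)"
proof -
  have lt: "js ! j < n" if "j < r" for j
    using js(1) that subsetD[OF js(2) nth_mem, of j] by simp
  have "col A j \<in> carrier_vec r" for j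
    using A by auto
  then have carrier: "map (col A) js ! j \<in> carrier_vec r" if "j < r" for j
    using js(1) that by simp
  have "mat_of_cols r (map (col (M * A)) js) = M * mat_of_cols r (map (col A) js)"
    using M A js lt by (intro eq_matI) (auto simp: mat_of_cols_index col_mat_of_cols[OF _ carrier])
  moreover have "mat_of_cols r (map (col A) js) \<in> carrier_mat r r"
    using js(1) by (auto simp: mat_of_cols_def)
  ultimately show ?thesis
    using det_mult[OF M, of "mat_of_cols r (map (col A) js)"] js(1) by (simp add: col_det_def)
qed

lemma minor_neq_0_iff:
  assumes A: "A \<in> carrier_mat r n" and l: "l \<in> brackets r n"
  shows "minor A l \<noteq> 0 \<longleftrightarrow> inj_on (col A) l \<and> cindep r (col A ` l)"
proof -
  interpret vec_space "TYPE(complex)" r .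
  let ?vs = "map (col A) (sorted_list_of_set l)"
  let ?M = "mat_of_cols r ?vs"
  from brackets_sorted_list[OF l] have fin: "finite l" and len: "length ?vs = r" by auto
  have M: "?M \<in> carrier_mat r r" using len by (auto simp: mat_of_cols_def)
  have cols: "cols ?M = ?vs" using A by (intro cols_mat_of_cols) auto
  have det: "minor A l = det ?M"
    using minor_eq_col_det[OF A l] len by (simp only: col_det_def)
  have set: "set (cols ?M) = col A ` l" and dist: "distinct (cols ?M) \<longleftrightarrow> inj_on (col A) l"
    unfolding cols using fin by (simp_all add: distinct_map)
  show ?thesis
  proof
    assume "minor A l \<noteq> 0"
    then show "inj_on (col A) l \<and> cindep r (col A ` l)"
      using lin_dep_cols_imp_det_0[OF M] col_det_not_distinct[of ?vs] minor_eq_col_det[OF A l]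
        brackets_sorted_list[OF l]
      unfolding det set dist[symmetric] cols by auto
  next
    assume "inj_on (col A) l \<and> cindep r (col A ` l)"
    then show "minor A l \<noteq> 0"
      using lin_depI[OF M] det_0_iff_vec_prod_zero_field[OF M] unfolding det set dist[symmetric] by blast
  qed
qed

lemma rows_in_span_factor:
  assumes A: "A \<in> carrier_mat r n" and B: "B \<in> carrier_mat r n"
    and sub: "set (rows B) \<subseteq> cspan n (set (rows A))"
  obtains M where "M \<in> carrier_mat r r" "B = M * A"
proof -
  interpret vec_space "TYPE(complex)" n .
  have "\<exists>y\<in>carrier_vec r. A\<^sup>T *\<^sub>v y = row B i" if "i < r" for i
  proof -
    have "row B i \<in> set (rows B)" using that B by (auto simp: rows_def)
    with sub have "row B i \<in> row_space A" by (auto simp: row_space_def)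
    then show ?thesis using row_space_eq[OF A] A by auto
  qed
  then obtain y where y: "\<And>i. i < r \<Longrightarrow> y i \<in> carrier_vec r \<and> A\<^sup>T *\<^sub>v y i = row B i"
    by metis
  show ?thesis
  proof
    show "mat r r (\<lambda>(i, k). y i $ k) \<in> carrier_mat r r" by simp
    show "B = mat r r (\<lambda>(i, k). y i $ k) * A"
    proof (rule eq_matI)
      fix i j assume "i < dim_row (mat r r (\<lambda>(i, k). y i $ k) * A)" "j < dim_col (mat r r (\<lambda>(i, k). y i $ k) * A)"
      then have ij: "i < r" "j < n" using A by auto
      then have "B $$ (i, j) = (A\<^sup>T *\<^sub>v y i) $ j" using y B by simp
      also have "\<dots> = col A j \<bullet> y i" using ij A by simp
      also have "\<dots> = y i \<bullet> col A j" using y[OF ij(1)] A by (intro comm_scalar_prod[of _ r]) auto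
      also have "\<dots> = (mat r r (\<lambda>(i, k). y i $ k) * A) $$ (i, j)"
        using ij A y[OF ij(1)] by (auto simp: scalar_prod_def)
      finally show "B $$ (i, j) = (mat r r (\<lambda>(i, k). y i $ k) * A) $$ (i, j)" .
    qed (use A B in auto)
  qed
qed

text \<open>The definition of \<open>matroid_bases\<close> lets the representing matrix vary with the basis. Two
  representing matrices differ by a square factor on the left, which multiplies all minors by its
  determinant, so one matrix decides about all bases.\<close>

lemma matroid_bases_iff_minor:
  assumes rep: "represents r n A x"
  shows "l \<in> matroid_bases r n x \<longleftrightarrow> l \<in> brackets r n \<and> minor A l \<noteq> 0"
proof
  assume "l \<in> brackets r n \<and> minor A l \<noteq> 0"
  then show "l \<in> matroid_bases r n x"
    using rep minor_neq_0_iff[of A r n l] by (auto simp: matroid_bases_def represents_def)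
next
  assume "l \<in> matroid_bases r n x"
  then obtain B where l: "l \<in> brackets r n" and B: "represents r n B x" and "minor B l \<noteq> 0"
    using minor_neq_0_iff[of _ r n l] by (auto simp: matroid_bases_def represents_def)
  interpret vec_space "TYPE(complex)" n .
  have "set (rows B) \<subseteq> cspan n (set (rows B))"
    using B by (intro in_own_span) (auto simp: represents_def rows_def)
  then obtain M where M: "M \<in> carrier_mat r r" "B = M * A"
    using rep B rows_in_span_factor[of A r n B] by (auto simp: represents_def)
  have AB: "A \<in> carrier_mat r n" "B \<in> carrier_mat r n"
    using rep B by (auto simp: represents_def)
  have "minor B l = det M * minor A l"
    unfolding minor_eq_col_det[OF AB(1) l] minor_eq_col_det[OF AB(2) l] unfolding M(2)
    by (rule col_det_mult[OF M(1) AB(1)]) (use brackets_sorted_list[OF l] in auto)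
  with \<open>minor B l \<noteq> 0\<close> l show "l \<in> brackets r n \<and> minor A l \<noteq> 0" by auto
qed

text \<open>A linear relation among the rows, in particular the equality of two rows, restricts to the square
  submatrix on the columns \<open>l\<close> and makes its determinant vanish.\<close>

lemma represents_row_span:
  assumes A: "A \<in> carrier_mat r n" and l: "l \<in> brackets r n" and "minor A l \<noteq> 0"
  shows "represents r n A (cspan n (set (rows A)))"
proof -
  interpret vec_space "TYPE(complex)" n .
  let ?js = "sorted_list_of_set l"
  let ?M = "mat_of_cols r (map (col A) ?js)"
  note len = brackets_sorted_list(2)[OF l]
  have lt: "?js ! j < n" if "j < r" for j
    using that nth_mem[of j ?js] brackets_sorted_list[OF l] by auto
  have M: "?M \<in> carrier_mat r r" using len by (auto simp: mat_of_cols_def)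
  have det: "det ?M \<noteq> 0"
    using assms(3) len minor_eq_col_det[OF A l] by (simp add: col_det_def)
  have dist: "distinct (rows A)"
  proof (rule ccontr)
    assume "\<not> distinct (rows A)"
    then obtain i j where ij: "i < r" "j < r" "i \<noteq> j" "row A i = row A j"
      using A by (auto simp: distinct_conv_nth)
    have "row ?M i = row ?M j"
    proof (rule eq_vecI)
      fix k assume "k < dim_vec (row ?M j)"
      then have k: "k < r" using len by simp
      have "row A i $ (?js ! k) = row A j $ (?js ! k)" by (simp only: ij)
      then show "row ?M i $ k = row ?M j $ k"
        using k ij(1,2) lt[OF k] A len by (simp add: mat_of_cols_index)
    qed simp
    then have "det ?M = 0"
      by (rule det_identical_rows[OF M ij(3,1,2)])
    with det show False by simp
  qed
  moreover have "lin_indpt (set (rows A))"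
  proof
    assume dep: "lin_dep (set (rows A))"
    obtain v where v: "v \<in> carrier_vec r" "v \<noteq> 0\<^sub>v r" "A\<^sup>T *\<^sub>v v = 0\<^sub>v n"
      by (rule lin_depE[of "A\<^sup>T" r]) (use A dep dist in auto)
    have "?M\<^sup>T *\<^sub>v v = 0\<^sub>v r"
    proof (rule eq_vecI)
      fix k assume "k < dim_vec (0\<^sub>v r :: complex vec)"
      then have k: "k < r" by simp
      have "(A\<^sup>T *\<^sub>v v) $ (?js ! k) = 0" using v(3) lt[OF k] by simp
      then show "(?M\<^sup>T *\<^sub>v v) $ k = 0\<^sub>v r $ k"
        using k lt[OF k] A len by simp
    qed (use len in simp)
    then have "det ?M\<^sup>T = 0"
      using v M by (subst det_0_iff_vec_prod_zero_field[of _ r]) auto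
    with det det_transpose[OF M] show False by simp
  qed
  ultimately show ?thesis
    using A by (simp add: represents_def)
qed

text \<open>This transports incidences of columns from \<open>x\<close> to every point of its stratum.\<close>

lemma col_det_zero_iff_of_same_matroid:
  assumes A: "represents r n A x" and B: "represents r n B y"
    and same: "matroid_bases r n y = matroid_bases r n x"
    and js: "length js = r" "set js \<subseteq> {..<n}"
  shows "col_det (map (col B) js) = 0 \<longleftrightarrow> col_det (map (col A) js) = 0"
proof (cases "distinct js")
  case True
  have carrier: "A \<in> carrier_mat r n" "B \<in> carrier_mat r n"
    using A B by (simp_all add: represents_def)
  have "set js \<in> brackets r n"
    using js True by (simp add: brackets_def distinct_card)
  then show ?thesis
    using matroid_bases_iff_minor[OF A, of "set js"] matroid_bases_iff_minor[OF B, of "set js"] same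
    by (simp add: col_det_eq_minor[OF carrier(1) js(1) True js(2)]
        col_det_eq_minor[OF carrier(2) js(1) True js(2)])
next
  case False
  then show ?thesis by (simp add: col_det_not_distinct distinct_map)
qed

text \<open>The zero locus of a single homogeneous element is closed, so it contains the closure of the
  stratum as soon as it contains the stratum.\<close>

lemma residue_class_in_matroid_ideal:
  assumes p: "p \<in> forms (brackets r n) k"
    and vanish: "\<And>y B. y \<in> matroid_stratum r n x \<Longrightarrow> represents r n B y \<Longrightarrow> eval_at (minor B) p = 0"
  shows "residue_class r n p \<in> matroid_ideal r n x"
proof -
  let ?f = "residue_class r n p"
  have "vanishes_at r n ?f y" if y: "y \<in> matroid_stratum r n x" for y
    unfolding vanishes_at_def
  proof (intro allI impI)
    fix B q assume B: "represents r n B y" and q: "q \<in> ?f"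
    interpret pluecker_point r n "minor B"
      by (rule pluecker_point_minor) (use B in \<open>simp add: represents_def\<close>)
    show "eval_at (minor B) q = 0"
      using eval_residue[OF q] vanish[OF y B] by simp
  qed
  then have "matroid_stratum r n x \<subseteq> zero_locus r n {?f}"
    by (auto simp: zero_locus_def matroid_stratum_def)
  moreover have "zariski_closed r n (zero_locus r n {?f})"
    unfolding zariski_closed_def
  proof (intro exI[of _ "{?f}"] conjI refl ballI)
    fix f assume "f \<in> {?f}"
    with p have "homogeneous r n k f"
      unfolding homogeneous_def by (intro bexI[of _ p]) simp_all
    then show "\<exists>k. homogeneous r n k f" ..
  qed
  ultimately have "matroid_variety r n x \<subseteq> zero_locus r n {?f}"
    unfolding matroid_variety_def zariski_closure_def by blast
  moreover have "?f \<in> carrier (coord_ring r n)"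
    using p by (intro residue_class_in_coord_ring) (simp add: forms_def)
  ultimately show ?thesis
    by (auto simp: matroid_ideal_def zero_locus_def)
qed

section \<open>Points on a rational normal curve\<close>

text \<open>Each pair of list entries contributes one factor, with the earlier entry as the first argument of
  \<open>g\<close>. Two products of such terms agree for every \<open>g\<close> if their lists contain the same ordered
  pairs with the same multiplicities.\<close>

fun pair_prod :: "('p \<Rightarrow> 'p \<Rightarrow> complex) \<Rightarrow> 'p list \<Rightarrow> complex" where
  "pair_prod g [] = 1"
| "pair_prod g (p # ps) = prod_list (map (g p) ps) * pair_prod g ps"

text \<open>The homogeneous Vandermonde matrix of points \<open>(s, t)\<close> of the projective line, in which the point
  at infinity is like any other.\<close>

definition vandermonde :: "(complex \<times> complex) list \<Rightarrow> complex mat" where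
  "vandermonde ps = mat (length ps) (length ps)
     (\<lambda>(i, j). fst (ps ! j) ^ (length ps - 1 - i) * snd (ps ! j) ^ i)"

lemma det_scale_cols:
  "det (mat n n (\<lambda>(i, j). f i j * c j)) = det (mat n n (\<lambda>(i, j). f i j)) * (\<Prod>j<n. c j :: complex)"
proof -
  have "mat n n (\<lambda>(i, j). f i j * c j) = mat n n (\<lambda>(i, j). f i j) * mat_diag n c"
    by (subst mat_diag_mult_right[of _ n]) (auto intro!: eq_matI)
  moreover have "det (mat_diag n c) = (\<Prod>j<n. c j)"
    by (subst det_upper_triangular[of _ n])
      (auto simp: mat_diag_def diag_mat_def upper_triangular_def prod.list_conv_set_nth lessThan_atLeast0 intro!: prod.cong)
  ultimately show ?thesis
    by (simp add: det_mult[of _ n])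
qed

lemma prod_list_map_nth: "prod_list (map f xs) = (\<Prod>j<length xs. f (xs ! j))"
  by (simp add: prod.list_conv_set_nth lessThan_atLeast0)

text \<open>Induction on the points. For the first point \<open>(a, b)\<close> with \<open>a \<noteq> 0\<close>, replacing each row but the first by \<open>a\<close> times
  itself minus \<open>b\<close> times the row above clears the first column below its top entry, and the
  remaining block is the smaller matrix with its columns scaled. For \<open>a = 0\<close> the first column has
  only its bottom entry, and the complementary block is again a scaled smaller matrix.\<close>

lemma det_vandermonde:
  "det (vandermonde ps) = pair_prod (\<lambda>p q. fst p * snd q - fst q * snd p) ps"
proof (induction ps)
  case Nil
  then show ?case by (simp add: vandermonde_def)
next
  case (Cons p ps)
  define n where "n = length ps"
  define a b where "a = fst p" and "b = snd p"
  let ?x = "\<lambda>j. fst (ps ! j)" and ?y = "\<lambda>j. snd (ps ! j)"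
  let ?V = "mat n n (\<lambda>(i, j). ?x j ^ (n - 1 - i) * ?y j ^ i)"
  let ?N = "vandermonde (p # ps)"
  have V: "vandermonde ps = ?V"
    by (simp add: vandermonde_def n_def)
  have N: "?N \<in> carrier_mat (Suc n) (Suc n)"
    by (simp add: vandermonde_def n_def)
  have N_0: "?N $$ (i, 0) = a ^ (n - i) * b ^ i" if "i \<le> n" for i
    using that by (simp add: vandermonde_def n_def a_def b_def)
  have N_Suc: "?N $$ (i, Suc j) = ?x j ^ (n - i) * ?y j ^ i" if "i \<le> n" "j < n" for i j
    using that by (simp add: vandermonde_def n_def)
  have "det ?N = (\<Prod>j<n. a * ?y j - ?x j * b) * det ?V"
  proof (cases "a = 0")
    case True
    have zero: "(\<Sum>i<n. ?N $$ (i, 0) * cofactor ?N i 0) = 0"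
      using N_0 True by (intro sum.neutral) auto
    have "det ?N = (\<Sum>i<Suc n. ?N $$ (i, 0) * cofactor ?N i 0)"
      by (rule laplace_expansion_column[OF N]) simp
    also have "\<dots> = b ^ n * cofactor ?N n 0"
      using zero N_0[of n] by simp
    also have "mat_delete ?N n 0 = mat n n (\<lambda>(i, j). (?x j ^ (n - 1 - i) * ?y j ^ i) * ?x j)"
    proof (rule eq_matI)
      fix i j assume "i < dim_row (mat n n (\<lambda>(i, j). (?x j ^ (n - 1 - i) * ?y j ^ i) * ?x j))"
        "j < dim_col (mat n n (\<lambda>(i, j). (?x j ^ (n - 1 - i) * ?y j ^ i) * ?x j))"
      then have ij: "i < n" "j < n" by simp_all
      then have "n - i = Suc (n - 1 - i)" by simp
      with ij show "mat_delete ?N n 0 $$ (i, j)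
          = mat n n (\<lambda>(i, j). (?x j ^ (n - 1 - i) * ?y j ^ i) * ?x j) $$ (i, j)"
        using N N_Suc[of i j] by (simp add: mat_delete_def)
    qed (use N in auto)
    then have "cofactor ?N n 0 = (-1) ^ n * (det ?V * (\<Prod>j<n. ?x j))"
      by (simp add: cofactor_def det_scale_cols)
    also have "b ^ n * ((-1) ^ n * (det ?V * (\<Prod>j<n. ?x j))) = (\<Prod>j<n. a * ?y j - ?x j * b) * det ?V"
      by (simp add: True prod_uminus prod.distrib)
    finally show ?thesis .
  next
    case False
    (* the matrix of the row operations; its determinant a ^ n is cancelled at the end *)
    define L where "L = mat (Suc n) (Suc n)
      (\<lambda>(i, k). if k = i then (if i = 0 then 1 else a) else if Suc k = i then - b else 0)"
    have L: "L \<in> carrier_mat (Suc n) (Suc n)"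
      by (simp add: L_def)
    have "det L = prod_list (diag_mat L)"
      by (rule det_lower_triangular[OF _ L]) (simp add: L_def)
    also have "\<dots> = (\<Prod>i<Suc n. L $$ (i, i))"
      using L by (simp add: prod_list_diag_prod lessThan_atLeast0)
    also have "\<dots> = a ^ n"
      unfolding prod.lessThan_Suc_shift by (simp add: L_def)
    finally have det_L: "det L = a ^ n" .
    have LN: "(L * ?N) $$ (Suc i, j) = a * ?N $$ (Suc i, j) - b * ?N $$ (i, j)" if "i < n" "j \<le> n" for i j
    proof -
      have "(L * ?N) $$ (Suc i, j) = (\<Sum>k<Suc n. L $$ (Suc i, k) * ?N $$ (k, j))"
        using that L N by (auto simp: scalar_prod_def lessThan_atLeast0 intro!: sum.cong)
      also have "\<dots> = (\<Sum>k\<in>{Suc i, i}. L $$ (Suc i, k) * ?N $$ (k, j))"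
        by (rule sum.mono_neutral_right) (use that in \<open>auto simp: L_def\<close>)
      also have "\<dots> = a * ?N $$ (Suc i, j) - b * ?N $$ (i, j)"
        using that by (simp add: L_def)
      finally show ?thesis .
    qed
    have LN_0: "(L * ?N) $$ (0, j) = ?N $$ (0, j)" if "j \<le> n" for j
    proof -
      have "(L * ?N) $$ (0, j) = (\<Sum>k<Suc n. L $$ (0, k) * ?N $$ (k, j))"
        using that L N by (auto simp: scalar_prod_def lessThan_atLeast0 intro!: sum.cong)
      also have "\<dots> = (\<Sum>k\<in>{0}. L $$ (0, k) * ?N $$ (k, j))"
        by (rule sum.mono_neutral_right) (auto simp: L_def)
      finally show ?thesis by (simp add: L_def)
    qed
    have carrier: "L * ?N \<in> carrier_mat (Suc n) (Suc n)"
      using L N by simp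
    have zero: "(L * ?N) $$ (Suc i, 0) = 0" if i: "i < n" for i
    proof -
      have "n - i = Suc (n - Suc i)" using i by simp
      then show ?thesis
        using i by (simp add: LN N_0)
    qed
    have "a ^ n * det ?N = det (L * ?N)"
      using det_mult[OF L N] det_L by simp
    also have "\<dots> = (\<Sum>i<Suc n. (L * ?N) $$ (i, 0) * cofactor (L * ?N) i 0)"
      by (rule laplace_expansion_column[OF carrier]) simp
    also have "\<dots> = a ^ n * cofactor (L * ?N) 0 0"
      unfolding sum.lessThan_Suc_shift using zero LN_0[of 0] N_0[of 0] by (simp del: index_mult_mat)
    also have "mat_delete (L * ?N) 0 0 = mat n n (\<lambda>(i, j). (?x j ^ (n - 1 - i) * ?y j ^ i) * (a * ?y j - ?x j * b))"
    proof (rule eq_matI)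
      fix i j assume "i < dim_row (mat n n (\<lambda>(i, j). (?x j ^ (n - 1 - i) * ?y j ^ i) * (a * ?y j - ?x j * b)))"
        "j < dim_col (mat n n (\<lambda>(i, j). (?x j ^ (n - 1 - i) * ?y j ^ i) * (a * ?y j - ?x j * b)))"
      then have ij: "i < n" "j < n" by simp_all
      then have "n - i = Suc (n - 1 - i)" by simp
      with ij have "(L * ?N) $$ (Suc i, Suc j) = (?x j ^ (n - 1 - i) * ?y j ^ i) * (a * ?y j - ?x j * b)"
        by (simp add: LN N_Suc algebra_simps)
      with ij show "mat_delete (L * ?N) 0 0 $$ (i, j)
          = mat n n (\<lambda>(i, j). (?x j ^ (n - 1 - i) * ?y j ^ i) * (a * ?y j - ?x j * b)) $$ (i, j)"
        using carrier_matD[OF carrier] by (simp add: mat_delete_def del: index_mult_mat)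
    qed (use L N in auto)
    then have "cofactor (L * ?N) 0 0 = (\<Prod>j<n. a * ?y j - ?x j * b) * det ?V"
      by (simp add: cofactor_def det_scale_cols)
    finally show ?thesis
      using False by simp
  qed
  then show ?case
    using Cons.IH by (simp add: V prod_list_map_nth n_def a_def b_def)
qed

definition binary_monomial :: "nat \<Rightarrow> nat \<Rightarrow> nat \<Rightarrow>\<^sub>0 nat" where
  "binary_monomial d k = Poly_Mapping.single 0 (d - k) + Poly_Mapping.single 1 k"

lemma monomial_at_binary_monomial: "monomial_at a (binary_monomial d k) = a 0 ^ (d - k) * a 1 ^ k"
proof -
  have "monomial_at a (Poly_Mapping.single v k) = a v ^ k" for v :: nat and k
    by (subst monomial_at_superset[of "{v}"]) auto
  then show ?thesis
    by (simp add: binary_monomial_def monomial_at_add)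
qed

lemma keys_binary_form:
  assumes "G \<in> forms {0, 1 :: nat} d"
  shows "Poly_Mapping.keys G \<subseteq> binary_monomial d ` {..d}"
proof
  fix m assume m: "m \<in> Poly_Mapping.keys G"
  with assms have keys: "Poly_Mapping.keys m \<subseteq> {0, 1}"
    and deg: "(\<Sum>v\<in>Poly_Mapping.keys m. Poly_Mapping.lookup m v) = d"
    by (auto simp: forms_def poly_ring_def)
  have "(\<Sum>v\<in>Poly_Mapping.keys m. Poly_Mapping.lookup m v) = (\<Sum>v\<in>{0, 1}. Poly_Mapping.lookup m v)"
    by (rule sum.mono_neutral_left) (use keys in \<open>auto simp: in_keys_iff\<close>)
  with deg have d: "Poly_Mapping.lookup m 0 + Poly_Mapping.lookup m 1 = d" by simp
  have "m = binary_monomial d (Poly_Mapping.lookup m 1)"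
  proof (rule poly_mapping_eqI)
    fix v
    have "v \<notin> {0, 1} \<Longrightarrow> Poly_Mapping.lookup m v = 0"
      using keys by (auto simp: in_keys_iff)
    then show "Poly_Mapping.lookup m v = Poly_Mapping.lookup (binary_monomial d (Poly_Mapping.lookup m 1)) v"
      using d by (auto simp: binary_monomial_def lookup_add lookup_single when_def)
  qed
  with d show "m \<in> binary_monomial d ` {..d}" by auto
qed

lemma eval_at_binary_form:
  assumes "G \<in> forms {0, 1 :: nat} d"
  shows "eval_at a G = (\<Sum>k\<le>d. Poly_Mapping.lookup G (binary_monomial d k) * (a 0 ^ (d - k) * a 1 ^ k))"
proof -
  have "Poly_Mapping.lookup (binary_monomial d k) 1 = k" for k
    by (simp add: binary_monomial_def lookup_add lookup_single)
  then have "inj_on (binary_monomial d) {..d}"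
    by (metis inj_onI)
  then show ?thesis
    using keys_binary_form[OF assms]
    by (subst eval_at_superset[of "binary_monomial d ` {..d}"])
      (auto simp: sum.reindex monomial_at_binary_monomial)
qed

definition veronese :: "nat \<Rightarrow> complex \<times> complex \<Rightarrow> complex vec" where
  "veronese d p = vec (d + 1) (\<lambda>k. fst p ^ (d - k) * snd p ^ k)"

text \<open>The rows of \<open>M\<close> are the coefficients of the forms \<open>F i\<close>. A vector in its left kernel would be a
  linear relation among the forms.\<close>

lemma forms_basis_matrix:
  assumes "forms_basis d F"
  obtains M where "M \<in> carrier_mat (d + 1) (d + 1)" "det M \<noteq> 0"
    "\<And>a. vec (d + 1) (\<lambda>i. eval_at a (F i)) = M *\<^sub>v veronese d (a 0, a 1)"
proof
  let ?M = "mat (d + 1) (d + 1) (\<lambda>(i, k). Poly_Mapping.lookup (F i) (binary_monomial d k))"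
  have F: "F i \<in> forms {0, 1} d" if "i \<le> d" for i
    using assms that by (simp add: forms_basis_def)
  show M: "?M \<in> carrier_mat (d + 1) (d + 1)" by simp
  show "det ?M \<noteq> 0"
  proof
    assume "det ?M = 0"
    then have "det ?M\<^sup>T = 0" using det_transpose[OF M] by simp
    then obtain v where v: "v \<in> carrier_vec (d + 1)" "v \<noteq> 0\<^sub>v (d + 1)" "?M\<^sup>T *\<^sub>v v = 0\<^sub>v (d + 1)"
      using M by (subst (asm) det_0_iff_vec_prod_zero_field[of _ "d + 1"]) auto
    have col: "(\<Sum>i\<le>d. v $ i * Poly_Mapping.lookup (F i) (binary_monomial d k)) = 0" if "k \<le> d" for k
    proof -
      have "(?M\<^sup>T *\<^sub>v v) $ k = 0" using v(3) that by simp
      then show ?thesis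
        using that v(1)
        by (simp add: scalar_prod_def mult.commute lessThan_Suc_atMost flip: lessThan_atLeast0)
    qed
    have "(\<Sum>i\<le>d. const (v $ i) * F i) = 0"
    proof (rule poly_mapping_eqI)
      fix m
      have "(\<Sum>i\<le>d. v $ i * Poly_Mapping.lookup (F i) m) = 0"
      proof (cases "m \<in> binary_monomial d ` {..d}")
        case True
        with col show ?thesis by auto
      next
        case False
        then have "Poly_Mapping.lookup (F i) m = 0" if "i \<le> d" for i
          using keys_binary_form[OF F[OF that]] by (auto simp: in_keys_iff)
        then show ?thesis by simp
      qed
      then show "Poly_Mapping.lookup (\<Sum>i\<le>d. const (v $ i) * F i) m = Poly_Mapping.lookup 0 m"
        by (simp add: lookup_sum lookup_const_mult)
    qed
    then have "\<forall>i\<le>d. v $ i = 0"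
      using assms unfolding forms_basis_def by blast
    then have "v = 0\<^sub>v (d + 1)" using v(1) by (intro eq_vecI) auto
    with v(2) show False by simp
  qed
  show "vec (d + 1) (\<lambda>i. eval_at a (F i)) = ?M *\<^sub>v veronese d (a 0, a 1)" for a
    by (rule eq_vecI)
      (auto simp: eval_at_binary_form[OF F] veronese_def scalar_prod_def lessThan_Suc_atMost
        simp flip: lessThan_atLeast0)
qed

lemma scalar_prod_span_zero:
  assumes w: "w \<in> carrier_vec r" and S: "S \<subseteq> carrier_vec r" and zero: "\<And>u. u \<in> S \<Longrightarrow> w \<bullet> u = 0"
    and v: "v \<in> cspan r S"
  shows "w \<bullet> v = 0"
proof -
  interpret vec_space "TYPE(complex)" r .
  obtain a U where U: "finite U" "U \<subseteq> S" and v: "v = lincomb a U"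
    using in_spanE[OF v] by blast
  have carrier: "U \<subseteq> carrier_vec r" using U S by blast
  have index: "v $ i = (\<Sum>u\<in>U. a u * u $ i)" if "i < r" for i
    using lincomb_index[OF that carrier, of a] v by simp
  have dim: "dim_vec v = r"
    unfolding v using lincomb_dim[OF U(1) carrier] .
  have "w \<bullet> v = (\<Sum>i<r. \<Sum>u\<in>U. a u * (w $ i * u $ i))"
    by (simp add: scalar_prod_def dim index sum_distrib_left lessThan_atLeast0 mult_ac)
  also have "\<dots> = (\<Sum>u\<in>U. a u * (w \<bullet> u))"
    using carrier by (subst sum.swap)
      (auto simp: scalar_prod_def sum_distrib_left lessThan_atLeast0 intro!: sum.cong)
  also have "\<dots> = 0"
    using zero U by (intro sum.neutral) auto
  finally show ?thesis .
qed

lemma span_pairE: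
  assumes carrier: "u \<in> carrier_vec r" "w \<in> carrier_vec r" and v: "v \<in> cspan r {u, w}"
  obtains a b where "v = a \<cdot>\<^sub>v u + b \<cdot>\<^sub>v w"
proof -
  interpret vec_space "TYPE(complex)" r .
  obtain c U where U: "U \<subseteq> {u, w}" and v: "v = lincomb c U"
    using in_spanE[OF v] by blast
  have fin: "finite U" and sub: "U \<subseteq> carrier_vec r"
    using U carrier finite_subset[OF U] by auto
  define a b where "a = (if u \<in> U then c u else 0)" and "b = (if w \<in> U \<and> w \<noteq> u then c w else 0)"
  have "v = a \<cdot>\<^sub>v u + b \<cdot>\<^sub>v w"
  proof (rule eq_vecI)
    fix i assume "i < dim_vec (a \<cdot>\<^sub>v u + b \<cdot>\<^sub>v w)"
    then have i: "i < r" using carrier by simp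
    have "v $ i = (\<Sum>x\<in>U. c x * x $ i)"
      using lincomb_index[OF i sub, of c] v by simp
    also have "\<dots> = (\<Sum>x\<in>{u, w}. (if x = u then a else b) * x $ i)"
      by (rule sum.mono_neutral_cong_left) (use U in \<open>auto simp: a_def b_def\<close>)
    finally show "v $ i = (a \<cdot>\<^sub>v u + b \<cdot>\<^sub>v w) $ i"
      using i carrier by (cases "u = w") (auto simp: b_def)
  qed (use carrier v lincomb_dim[OF fin sub] in simp)
  then show ?thesis by (rule that)
qed

lemma veronese_smult: "veronese d (e * fst p, e * snd p) = e ^ d \<cdot>\<^sub>v veronese d p"
  by (rule eq_vecI) (auto simp: veronese_def power_mult_distrib mult_ac simp flip: power_add)

lemma proj_point_smult:
  assumes "v \<in> carrier_vec n" "c \<noteq> 0"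
  shows "proj_point n (c \<cdot>\<^sub>v v) = proj_point n v"
proof -
  interpret vec_space "TYPE(complex)" n .
  have sub: "span {b \<cdot>\<^sub>v u} \<subseteq> span {u}" if "u \<in> carrier_vec n" for b u
    using that smult_in_span[of "{u}" u b] in_own_span[of "{u}"] by (intro span_subsetI) auto
  have "v = (1 / c) \<cdot>\<^sub>v (c \<cdot>\<^sub>v v)"
    using assms by (simp add: smult_smult_assoc)
  with sub[of "c \<cdot>\<^sub>v v" "1 / c"] sub[of v c] assms show ?thesis
    unfolding proj_point_def by auto
qed

text \<open>A scalar in front of a point of the Veronese curve is absorbed into the parameter, because it has
  a \<open>d\<close>-th root.\<close>

lemma homog_coords_veronese:
  assumes M: "M \<in> carrier_mat (d + 1) (d + 1)" and d: "d \<noteq> 0" and p: "p \<noteq> (0, 0)"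
    and v: "homog_coords (d + 1) v (proj_point (d + 1) (M *\<^sub>v veronese d p))"
  obtains q where "q \<noteq> (0, 0)" "v = M *\<^sub>v veronese d q"
proof -
  interpret vec_space "TYPE(complex)" "d + 1" .
  let ?u = "M *\<^sub>v veronese d p"
  have u: "?u \<in> carrier_vec (d + 1)" and ver: "veronese d p \<in> carrier_vec (d + 1)"
    using M by (auto simp: veronese_def)
  have "v \<in> span {v}" using v in_own_span[of "{v}"] by (auto simp: homog_coords_def)
  also have "span {v} = span {?u, ?u}"
    using v by (simp add: homog_coords_def proj_point_def)
  finally obtain a b where "v = a \<cdot>\<^sub>v ?u + b \<cdot>\<^sub>v ?u"
    using span_pairE[OF u u] by blast
  then have v': "v = (a + b) \<cdot>\<^sub>v ?u" using u by (simp add: add_smult_distrib_vec)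
  with v u have ab: "a + b \<noteq> 0" by (auto simp: homog_coords_def)
  obtain e where e: "e ^ d = a + b" using nth_root_exists[of d "a + b"] d by auto
  have "e \<noteq> 0" using e ab d by (auto simp: zero_power)
  show ?thesis
  proof
    show "(e * fst p, e * snd p) \<noteq> (0, 0)"
      using p \<open>e \<noteq> 0\<close> by (cases p) auto
    show "v = M *\<^sub>v veronese d (e * fst p, e * snd p)"
      using M ver by (simp add: v' veronese_smult e mult_mat_vec)
  qed
qed

lemma proportional_if_cross_zero:
  fixes p q :: "complex \<times> complex"
  assumes "p \<noteq> (0, 0)" "q \<noteq> (0, 0)" "fst p * snd q - fst q * snd p = 0"
  obtains e where "e \<noteq> 0" "q = (e * fst p, e * snd p)"
proof (cases "fst p = 0")
  case True
  with assms that[of "snd q / snd p"] show ?thesis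
    by (cases p; cases q) auto
next
  case False
  then have "fst q \<noteq> 0"
    using assms by (cases q) auto
  with False assms(3) that[of "fst q / fst p"] show ?thesis
    by (cases p; cases q) (auto simp: field_simps)
qed

lemma pair_prod_map: "pair_prod g (map h js) = pair_prod (\<lambda>i j. g (h i) (h j)) js"
  by (induction js) (simp_all add: o_def)

lemma pair_prod_nonzero:
  assumes "distinct js" "\<And>i j. i \<in> set js \<Longrightarrow> j \<in> set js \<Longrightarrow> i \<noteq> j \<Longrightarrow> g i j \<noteq> 0"
  shows "pair_prod g js \<noteq> 0"
  using assms by (induction js) (auto simp: prod_list_zero_iff, metis)

lemma col_det_veronese:
  assumes M: "M \<in> carrier_mat (d + 1) (d + 1)" and ps: "length ps = d + 1"
  shows "col_det (map (\<lambda>p. M *\<^sub>v veronese d p) ps)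
    = det M * pair_prod (\<lambda>p q. fst p * snd q - fst q * snd p) ps"
proof -
  have V: "vandermonde ps \<in> carrier_mat (d + 1) (d + 1)"
    using ps by (simp add: vandermonde_def)
  have col: "col (vandermonde ps) j = veronese d (ps ! j)" if "j < d + 1" for j
    using that ps by (intro eq_vecI) (auto simp: vandermonde_def veronese_def)
  have "mat_of_cols (d + 1) (map (\<lambda>p. M *\<^sub>v veronese d p) ps) = M * vandermonde ps"
    using M V ps col by (intro eq_matI) (auto simp: mat_of_cols_index)
  then show ?thesis
    using det_mult[OF M V] ps by (simp add: col_det_def det_vandermonde)
qed

text \<open>With the constant \<open>det M\<close> for \<open>c\<close> and the \<open>2 \<times> 2\<close> determinant of the parameters of \<open>i\<close> and \<open>j\<close> for
  \<open>g i j\<close>. These determinants do not vanish, since proportional parameters give the same point.\<close>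

lemma col_det_rational_normal_curve:
  assumes d: "d \<noteq> 0" and C: "rational_normal_curve d C"
    and P: "inj_on P J" "P ` J \<subseteq> C"
    and v: "\<And>j. j \<in> J \<Longrightarrow> homog_coords (d + 1) (v j) (P j)"
  obtains c g where "c \<noteq> 0" "\<And>i j. i \<in> J \<Longrightarrow> j \<in> J \<Longrightarrow> i \<noteq> j \<Longrightarrow> g i j \<noteq> 0"
    "\<And>js. length js = d + 1 \<Longrightarrow> set js \<subseteq> J \<Longrightarrow> col_det (map v js) = c * pair_prod g js"
proof -
  obtain F where F: "forms_basis d F"
    and C: "C = {proj_point (d + 1) (vec (d + 1) (\<lambda>i. eval_at a (F i))) | a. a 0 \<noteq> 0 \<or> a 1 \<noteq> 0}"
    using C unfolding rational_normal_curve_def by blast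
  obtain M where M: "M \<in> carrier_mat (d + 1) (d + 1)" "det M \<noteq> 0"
    "\<And>a. vec (d + 1) (\<lambda>i. eval_at a (F i)) = M *\<^sub>v veronese d (a 0, a 1)"
    using forms_basis_matrix[OF F] by blast
  have "\<exists>q. q \<noteq> (0, 0) \<and> v j = M *\<^sub>v veronese d q" if j: "j \<in> J" for j
  proof -
    obtain a :: "nat \<Rightarrow> complex" where a: "a 0 \<noteq> 0 \<or> a 1 \<noteq> 0"
      and Pj: "P j = proj_point (d + 1) (M *\<^sub>v veronese d (a 0, a 1))"
      using j P(2) unfolding C M(3) by blast
    have "(a 0, a 1) \<noteq> (0, 0)" using a by auto
    then show ?thesis
      using homog_coords_veronese[OF M(1) d _ v[OF j, unfolded Pj]] by metis
  qed
  then obtain q where q: "\<And>j. j \<in> J \<Longrightarrow> q j \<noteq> (0, 0)" "\<And>j. j \<in> J \<Longrightarrow> v j = M *\<^sub>v veronese d (q j)"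
    by metis
  let ?g = "\<lambda>i j. fst (q i) * snd (q j) - fst (q j) * snd (q i)"
  show ?thesis
  proof
    show "det M \<noteq> 0" by (rule M(2))
    fix i j assume ij: "i \<in> J" "j \<in> J" "i \<noteq> j"
    show "?g i j \<noteq> 0"
    proof
      assume "?g i j = 0"
      then obtain e where e: "e \<noteq> 0" "q j = (e * fst (q i), e * snd (q i))"
        using proportional_if_cross_zero[OF q(1)[OF ij(1)] q(1)[OF ij(2)]] by blast
      have "veronese d (q i) \<in> carrier_vec (d + 1)" by (simp add: veronese_def)
      then have "v j = e ^ d \<cdot>\<^sub>v v i"
        using M(1) ij by (simp add: q(2) e(2) veronese_smult mult_mat_vec)
      moreover have "v i \<in> carrier_vec (d + 1)" using v[OF ij(1)] by (simp add: homog_coords_def)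
      ultimately have "proj_point (d + 1) (v j) = proj_point (d + 1) (v i)"
        using e(1) by (simp add: proj_point_smult)
      then have "P i = P j"
        using v[OF ij(1)] v[OF ij(2)] by (simp add: homog_coords_def)
      with P(1) ij show False by (auto dest: inj_onD)
    qed
  next
    fix js assume js: "length js = d + 1" "set js \<subseteq> J"
    have map: "map v js = map (\<lambda>p. M *\<^sub>v veronese d p) (map q js)"
      using js(2) q(2) by auto
    have "length (map q js) = d + 1" using js(1) by simp
    from col_det_veronese[OF M(1) this] show "col_det (map v js) = det M * pair_prod ?g js"
      unfolding map pair_prod_map .
  qed
qed

section \<open>Pascal's theorem in a projective plane\<close>

text \<open>The brackets of points of a projective plane. The last law is Cramer's rule, the expansion of
  \<open>v\<close> in terms of \<open>p\<close>, \<open>q\<close> and \<open>r\<close>.\<close>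

locale plane_bracket =
  fixes br :: "'v \<Rightarrow> 'v \<Rightarrow> 'v \<Rightarrow> complex"
  assumes swap12: "br a b c = - br b a c"
    and swap23: "br a b c = - br a c b"
    and exchange: "br p q r * br v b c = br v q r * br p b c + br p v r * br q b c + br p q v * br r b c"
begin

lemma rotate: "br a b c = br b c a"
  using swap12[of a b c] swap23[of b a c] by simp

lemma repeated: "br a a c = 0" "br a c a = 0" "br c a a = 0"
  using swap12[of a a c] swap23[of c a a] rotate[of a a c] rotate[of a c a] by simp_all

text \<open>With \<open>p0\<close>, \<open>p1\<close>, \<open>p2\<close> as coordinate triangle this is a polynomial identity in the coordinates of the
  other three points.\<close>

lemma conic_identity:
  assumes t: "br p0 p1 p2 \<noteq> 0"
  shows "br p0 p1 p2 * br p1 p3 p4 * br p2 p4 p5 * br p0 p3 p5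
      - br p0 p1 p3 * br p1 p3 p4 * br p2 p4 p5 * br p0 p2 p5
      + br p0 p2 p3 * br p1 p3 p4 * br p1 p4 p5 * br p0 p2 p5
      - br p1 p2 p3 * br p0 p3 p4 * br p1 p4 p5 * br p0 p2 p5
    = br p0 p1 p2 * br p0 p3 p4 * br p1 p3 p5 * br p2 p4 p5
      - br p0 p1 p3 * br p0 p2 p4 * br p1 p2 p5 * br p3 p4 p5"
proof -
  define t where "t = br p0 p1 p2"
  (* Cramer coordinates of v in the triangle p0 p1 p2, multiplied by t *)
  define x y z where "x v = br p1 p2 v" and "y v = - br p0 p2 v" and "z v = br p0 p1 v" for v
  have t0: "t \<noteq> 0" using t by (simp add: t_def)
  have e2: "br p0 p1 v = z v" "br p0 p2 v = - y v" "br p1 p2 v = x v" for v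
    by (simp_all add: x_def y_def z_def)
  have ex: "t * br v b c = x v * br p0 b c + y v * br p1 b c + z v * br p2 b c" for v b c
    using exchange[of p0 p1 p2 v b c] rotate[of v p1 p2] swap23[of p0 v p2]
    by (simp add: x_def y_def z_def t_def)
  have "t * br p0 u v = y u * z v - z u * y v" for u v
    using ex[of u v p0] e2[of v] rotate[of p0 u v] rotate[of p0 p1 v] rotate[of p0 p2 v]
    by (simp add: repeated)
  moreover have "t * br p1 u v = z u * x v - x u * z v" for u v
    using ex[of u v p1] e2[of v] rotate[of p1 u v] swap23[of p0 v p1] rotate[of p1 p2 v] rotate[of u v p1]
    by (simp add: repeated)
  moreover have "t * br p2 u v = x u * y v - y u * x v" for u v
    using ex[of u v p2] e2[of v] rotate[of p2 u v] swap23[of p0 v p2] swap23[of p1 v p2]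
    by (simp add: repeated)
  ultimately have e1: "br p0 u v = (y u * z v - z u * y v) / t"
    "br p1 u v = (z u * x v - x u * z v) / t" "br p2 u v = (x u * y v - y u * x v) / t" for u v
    using t0 by (simp_all add: eq_divide_eq mult.commute)
  have e0: "br v b c = (x v * br p0 b c + y v * br p1 b c + z v * br p2 b c) / t" for v b c
    using ex[of v b c] t0 by (simp add: field_simps)
  have t': "br p0 p1 p2 = t" by (simp add: t_def)
  show ?thesis
    unfolding t' unfolding e2 unfolding e0[of p3 p4 p5] e1
    using t0 by (simp add: divide_simps) (simp add: algebra_simps)
qed

text \<open>Since \<open>q1\<close> is on the line \<open>p0 p1\<close>, it is a combination of \<open>p0\<close> and \<open>p1\<close>, and its incidence with
  \<open>p3 p4\<close> determines the ratio of the coefficients; similarly for \<open>q2\<close> and \<open>q3\<close>. Substituting into the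
  bracket of the three Pascal points gives a multiple of the left-hand side of
  \<open>conic_identity\<close>. The last condition on each Pascal point excludes that it degenerates, so
  the factor is not zero and both directions of Pascal's theorem follow.\<close>

theorem pascal_iff_conic:
  assumes t: "br p0 p1 p2 \<noteq> 0" "br p1 p2 p3 \<noteq> 0" "br p0 p2 p3 \<noteq> 0"
    and nz: "br p0 p3 p4 \<noteq> 0" "br p1 p4 p5 \<noteq> 0" "br p0 p2 p5 \<noteq> 0"
    and q1: "br p0 p1 q1 = 0" "br p3 p4 q1 = 0" "br p0 p3 q1 \<noteq> 0"
    and q2: "br p1 p2 q2 = 0" "br p4 p5 q2 = 0" "br p1 p3 q2 \<noteq> 0"
    and q3: "br p2 p3 q3 = 0" "br p0 p5 q3 = 0" "br p0 p2 q3 \<noteq> 0"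
  shows "br q1 q2 q3 = 0 \<longleftrightarrow>
    br p0 p1 p2 * br p0 p3 p4 * br p1 p3 p5 * br p2 p4 p5
      = br p0 p1 p3 * br p0 p2 p4 * br p1 p2 p5 * br p3 p4 p5"
proof -
  define s1 s2 s3 where "s1 = br p0 p1 p2" and "s2 = br p1 p2 p3" and "s3 = br p2 p3 p0"
  have s: "s1 \<noteq> 0" "s2 \<noteq> 0" "s3 \<noteq> 0"
    using t rotate[of p0 p2 p3] by (simp_all add: s1_def s2_def s3_def)
  have line: "\<exists>a e. \<forall>b c. br u v w * br q b c = a * br u b c + e * br v b c" if "br u v q = 0" for u v w q
    using exchange[of u v w q] that by auto
  obtain a1 b1 where l1: "\<And>b c. s1 * br q1 b c = a1 * br p0 b c + b1 * br p1 b c"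
    using line[OF q1(1), of p2] unfolding s1_def by blast
  obtain a2 b2 where l2: "\<And>b c. s2 * br q2 b c = a2 * br p1 b c + b2 * br p2 b c"
    using line[OF q2(1), of p3] unfolding s2_def by blast
  obtain a3 b3 where l3: "\<And>b c. s3 * br q3 b c = a3 * br p2 b c + b3 * br p3 b c"
    using line[OF q3(1), of p0] unfolding s3_def by blast
  have r1: "a1 * br p0 p3 p4 + b1 * br p1 p3 p4 = 0"
    using l1[of p3 p4] q1(2) rotate[of q1 p3 p4] by simp
  have r2: "a2 * br p1 p4 p5 + b2 * br p2 p4 p5 = 0"
    using l2[of p4 p5] q2(2) rotate[of q2 p4 p5] by simp
  have r3: "a3 * br p0 p2 p5 + b3 * br p0 p3 p5 = 0"
    using l3[of p0 p5] q3(2) rotate[of q3 p0 p5] swap12[of p2 p0 p5] swap12[of p3 p0 p5] by (simp add: add_eq_0_iff)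
  have b: "b1 \<noteq> 0" "b2 \<noteq> 0" "b3 \<noteq> 0"
    using l1[of p0 p3] l2[of p1 p3] l3[of p0 p2] q1(3) q2(3) q3(3) s
      rotate[of q1 p0 p3] rotate[of q2 p1 p3] rotate[of q3 p0 p2]
    by (auto simp: repeated)
  have "s3 * br p u q3 = a3 * br p u p2 + b3 * br p u p3" for p u
    using l3[of p u] rotate[of q3 p u] rotate[of p2 p u] rotate[of p3 p u] by simp
  moreover have "s2 * br p q2 v = a2 * br p p1 v + b2 * br p p2 v" for p v
    using l2[of p v] swap12[of q2 p v] swap12[of p1 p v] swap12[of p2 p v] by (simp add: algebra_simps)
  ultimately have e: "s2 * s3 * br p q2 q3 = a2 * (a3 * br p p1 p2 + b3 * br p p1 p3) + b2 * b3 * br p p2 p3" for p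
    by (smt (verit) add_0 distrib_left mult.assoc mult.left_commute mult_zero_right repeated(3))
  have T: "s1 * s2 * s3 * br q1 q2 q3 = a1 * a2 * a3 * br p0 p1 p2 + a1 * a2 * b3 * br p0 p1 p3
      + a1 * b2 * b3 * br p0 p2 p3 + b1 * b2 * b3 * br p1 p2 p3"
  proof -
    have "s1 * s2 * s3 * br q1 q2 q3 = a1 * (s2 * s3 * br p0 q2 q3) + b1 * (s2 * s3 * br p1 q2 q3)"
      using arg_cong[OF l1[of q2 q3], of "(*) (s2 * s3)"] by (simp add: algebra_simps)
    then show ?thesis
      unfolding e by (simp add: repeated algebra_simps)
  qed
  (* in this form a product of three a's is rewritten into b's without division *)
  have a: "a1 * br p0 p3 p4 = - b1 * br p1 p3 p4" "a2 * br p1 p4 p5 = - b2 * br p2 p4 p5"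
    "a3 * br p0 p2 p5 = - b3 * br p0 p3 p5"
    using r1 r2 r3 by (simp_all add: add_eq_0_iff2)
  have "s1 * s2 * s3 * (br p0 p3 p4 * br p1 p4 p5 * br p0 p2 p5) * br q1 q2 q3
    = (a1 * br p0 p3 p4) * (a2 * br p1 p4 p5) * (a3 * br p0 p2 p5) * br p0 p1 p2
      + (a1 * br p0 p3 p4) * (a2 * br p1 p4 p5) * (b3 * br p0 p2 p5) * br p0 p1 p3
      + (a1 * br p0 p3 p4) * (b2 * br p1 p4 p5) * (b3 * br p0 p2 p5) * br p0 p2 p3
      + (b1 * br p0 p3 p4) * (b2 * br p1 p4 p5) * (b3 * br p0 p2 p5) * br p1 p2 p3"
    using arg_cong[OF T, of "(*) (br p0 p3 p4 * br p1 p4 p5 * br p0 p2 p5)"] by (simp add: algebra_simps)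
  note times = this[unfolded a]
  have "s1 * s2 * s3 * (br p0 p3 p4 * br p1 p4 p5 * br p0 p2 p5) * br q1 q2 q3
    = - (b1 * b2 * b3) * (br p0 p1 p2 * br p0 p3 p4 * br p1 p3 p5 * br p2 p4 p5
      - br p0 p1 p3 * br p0 p2 p4 * br p1 p2 p5 * br p3 p4 p5)"
    unfolding conic_identity[OF t(1), symmetric] times
    by (simp add: algebra_simps)
  then show ?thesis
    using s nz b by auto
qed

end

lemma col_det_move_last: "col_det (ws @ us @ [v]) = (-1) ^ length us * col_det (ws @ v # us)"
proof (induction us arbitrary: ws)
  case (Cons u us)
  have "col_det (ws @ (u # us) @ [v]) = (-1) ^ length us * col_det (ws @ u # v # us)"
    using Cons.IH[of "ws @ [u]"] by simp
  also have "col_det (ws @ u # v # us) = - col_det (ws @ v # u # us)"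
    by (rule col_det_swap)
  finally show ?case by simp
qed simp

text \<open>Fixing the columns \<open>hs\<close> amounts to projecting from their span to a plane. The exchange law is the
  Grassmann-Pluecker relation for the lists \<open>b, c, hs\<close> and \<open>v, p, q, r', hs\<close>, in which only the
  first four terms survive; the exchanged column has to travel from the last place to the first,
  with the same sign in all terms.\<close>

lemma plane_bracket_col_det:
  assumes len: "length hs + 3 = r" and f: "\<And>i. f i \<in> carrier_vec r" and hs: "set hs \<subseteq> carrier_vec r"
  shows "plane_bracket (\<lambda>i j k. col_det ([f i, f j, f k] @ hs))"
proof
  show "col_det ([f a, f b, f c] @ hs) = - col_det ([f b, f a, f c] @ hs)" for a b c
    using col_det_swap[of "[]" "f a" "f b"] by simp
  show "col_det ([f a, f b, f c] @ hs) = - col_det ([f a, f c, f b] @ hs)" for a b c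
    using col_det_swap[of "[f a]" "f b" "f c"] by simp
  fix p q r' v b c
  let ?us = "[f b, f c] @ hs" and ?xs = "[f v, f p, f q, f r'] @ hs"
  let ?t = "\<lambda>k. (-1) ^ k * col_det (?us @ [?xs ! k]) * col_det (take k ?xs @ drop (Suc k) ?xs)"
  have zero: "?t k = 0" if "k \<in> {..r} - {0, 1, 2, 3}" for k
  proof -
    have "k - 4 < length hs" "?xs ! k = hs ! (k - 4)"
      using that len by (auto simp: nth_append nth_Cons' numeral_eq_Suc)
    then have "?xs ! k \<in> set ?us" using nth_mem by auto
    then have "\<not> distinct (?us @ [?xs ! k])" unfolding distinct_append by simp
    then have "col_det (?us @ [?xs ! k]) = 0" by (rule col_det_not_distinct)
    then show ?thesis by (simp only: mult_zero_right mult_zero_left)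
  qed
  have four: "sum h {0, 1, 2, 3} = h 0 + h 1 + h 2 + h 3" for h :: "nat \<Rightarrow> complex"
    by (simp add: add.assoc)
  have "0 = (\<Sum>k\<le>r. ?t k)"
    by (rule col_det_grassmann_pluecker[symmetric]) (use len f hs in auto)
  also have "\<dots> = (\<Sum>k\<in>{0, 1, 2, 3}. ?t k)"
    by (rule sum.mono_neutral_right) (use len zero in auto)
  also have "\<dots> = ?t 0 + ?t 1 + ?t 2 + ?t 3"
    by (rule four)
  finally have total: "?t 0 + ?t 1 + ?t 2 + ?t 3 = 0" by (rule sym)
  have terms: "?t 0 = col_det (?us @ [f v]) * col_det ([f p, f q, f r'] @ hs)"
    "?t 1 = - (col_det (?us @ [f p]) * col_det ([f v, f q, f r'] @ hs))"
    "?t 2 = col_det (?us @ [f q]) * col_det ([f v, f p, f r'] @ hs)"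
    "?t 3 = - (col_det (?us @ [f r']) * col_det ([f v, f p, f q] @ hs))"
    by (simp_all add: numeral_eq_Suc)
  have rel: "col_det (?us @ [f v]) * col_det ([f p, f q, f r'] @ hs)
      - col_det (?us @ [f p]) * col_det ([f v, f q, f r'] @ hs)
      + col_det (?us @ [f q]) * col_det ([f v, f p, f r'] @ hs)
      - col_det (?us @ [f r']) * col_det ([f v, f p, f q] @ hs) = 0"
    using total unfolding terms by (simp only: diff_conv_add_uminus)
  have move: "col_det (?us @ [f i]) = (-1) ^ length ?us * col_det ([f i, f b, f c] @ hs)" for i
    using col_det_move_last[of "[]" ?us "f i"] by simp
  have "(-1) ^ length ?us * (col_det ([f v, f b, f c] @ hs) * col_det ([f p, f q, f r'] @ hs)
      - col_det ([f p, f b, f c] @ hs) * col_det ([f v, f q, f r'] @ hs)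
      + col_det ([f q, f b, f c] @ hs) * col_det ([f v, f p, f r'] @ hs)
      - col_det ([f r', f b, f c] @ hs) * col_det ([f v, f p, f q] @ hs)) = 0"
    using rel unfolding move by (simp only: algebra_simps)
  then have "col_det ([f v, f b, f c] @ hs) * col_det ([f p, f q, f r'] @ hs)
      - col_det ([f p, f b, f c] @ hs) * col_det ([f v, f q, f r'] @ hs)
      + col_det ([f q, f b, f c] @ hs) * col_det ([f v, f p, f r'] @ hs)
      - col_det ([f r', f b, f c] @ hs) * col_det ([f v, f p, f q] @ hs) = 0"
    by (simp only: mult_eq_0_iff power_not_zero) simp
  moreover have "col_det ([f v, f p, f r'] @ hs) = - col_det ([f p, f v, f r'] @ hs)"
    "col_det ([f v, f p, f q] @ hs) = col_det ([f p, f q, f v] @ hs)"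
    using col_det_swap[of "[]" "f v" "f p"] col_det_swap[of "[f p]" "f v" "f q"] by simp_all
  ultimately show "col_det ([f p, f q, f r'] @ hs) * col_det ([f v, f b, f c] @ hs)
      = col_det ([f v, f q, f r'] @ hs) * col_det ([f p, f b, f c] @ hs)
      + col_det ([f p, f v, f r'] @ hs) * col_det ([f q, f b, f c] @ hs)
      + col_det ([f p, f q, f v] @ hs) * col_det ([f r', f b, f c] @ hs)"
    by (simp add: algebra_simps)
qed

section \<open>The conic quartic\<close>

text \<open>The condition that the projections of the first six points from the span of \<open>hs\<close> lie on a
  conic.\<close>

definition conic_quartic :: "nat list \<Rightarrow> nat set cpoly" where
  "conic_quartic hs =
     bracket ([0, 1, 2] @ hs) * bracket ([0, 3, 4] @ hs) * bracket ([1, 3, 5] @ hs) * bracket ([2, 4, 5] @ hs)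
   - bracket ([0, 1, 3] @ hs) * bracket ([0, 2, 4] @ hs) * bracket ([1, 2, 5] @ hs) * bracket ([3, 4, 5] @ hs)"

lemma conic_quartic_in_forms:
  assumes "length hs + 3 = r" "set hs \<subseteq> {..<n}" "6 \<le> n"
  shows "conic_quartic hs \<in> forms (brackets r n) 4"
proof -
  have "bracket ([i, j, k] @ hs) \<in> forms (brackets r n) 1" if "i < 6" "j < 6" "k < 6" for i j k
    by (rule bracket_in_forms) (use assms that in auto)
  then have four: "bracket ([a, b, c] @ hs) * bracket ([a', b', c'] @ hs) * bracket ([i, j, k] @ hs) * bracket ([i', j', k'] @ hs)
      \<in> forms (brackets r n) (1 + 1 + 1 + 1)"
    if "a < 6" "b < 6" "c < 6" "a' < 6" "b' < 6" "c' < 6" "i < 6" "j < 6" "k < 6" "i' < 6" "j' < 6" "k' < 6"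
    for a b c a' b' c' i j k i' j' k'
    using that by (intro forms_mult) auto
  have "conic_quartic hs \<in> forms (brackets r n) (1 + 1 + 1 + 1)"
    unfolding conic_quartic_def by (intro forms_diff four) simp_all
  then show ?thesis by (simp add: numeral_eq_Suc)
qed

lemma eval_at_conic_quartic:
  fixes B hs defines "br \<equiv> \<lambda>i j k. col_det (map (col B) ([i, j, k] @ hs))"
  assumes B: "B \<in> carrier_mat r n" and "length hs + 3 = r" "set hs \<subseteq> {..<n}" "6 \<le> n"
  shows "eval_at (minor B) (conic_quartic hs) =
    br 0 1 2 * br 0 3 4 * br 1 3 5 * br 2 4 5 - br 0 1 3 * br 0 2 4 * br 1 2 5 * br 3 4 5"
proof -
  have "eval_at (minor B) (bracket ([i, j, k] @ hs)) = br i j k" if "i < 6" "j < 6" "k < 6" for i j k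
    unfolding br_def by (rule eval_at_bracket[OF B]) (use assms that in auto)
  then show ?thesis
    by (simp add: conic_quartic_def eval_at_diff eval_at_mult del: append.simps)
qed

lemma conic_quartic_vanishes_iff:
  fixes B hs defines "br \<equiv> \<lambda>i j k. col_det (map (col B) ([i, j, k] @ hs))"
  assumes B: "B \<in> carrier_mat r n" and hs: "length hs + 3 = r" "set hs \<subseteq> {..<n}" "6 \<le> n"
    and t: "br 0 1 2 \<noteq> 0" "br 1 2 3 \<noteq> 0" "br 0 2 3 \<noteq> 0"
      "br 0 3 4 \<noteq> 0" "br 1 4 5 \<noteq> 0" "br 0 2 5 \<noteq> 0"
    and q1: "br 0 1 q1 = 0" "br 3 4 q1 = 0" "br 0 3 q1 \<noteq> 0"
    and q2: "br 1 2 q2 = 0" "br 4 5 q2 = 0" "br 1 3 q2 \<noteq> 0"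
    and q3: "br 2 3 q3 = 0" "br 0 5 q3 = 0" "br 0 2 q3 \<noteq> 0"
  shows "eval_at (minor B) (conic_quartic hs) = 0 \<longleftrightarrow> br q1 q2 q3 = 0"
proof -
  have col: "col B i \<in> carrier_vec r" for i using B by auto
  have br: "br = (\<lambda>i j k. col_det ([col B i, col B j, col B k] @ map (col B) hs))"
    by (simp add: br_def)
  interpret plane_bracket br
    unfolding br by (rule plane_bracket_col_det) (use hs(1) col in auto)
  show ?thesis
    using pascal_iff_conic[OF t q1 q2 q3] eval_at_conic_quartic[OF B hs]
    unfolding br_def by simp
qed

lemma col_det_unit_vecs: "col_det (map (unit_vec r) [0..<r]) = 1"
proof -
  have "mat_of_cols r (map (unit_vec r) [0..<r]) = (1\<^sub>m r :: complex mat)"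
    by (rule eq_matI) (auto simp: mat_of_cols_index)
  then show ?thesis
    unfolding col_det_def length_map length_upt diff_zero by (simp only: det_one)
qed

text \<open>The first six columns project to the points \<open>e\<^sub>0\<close>, \<open>e\<^sub>1\<close>, \<open>e\<^sub>2\<close>, \<open>e\<^sub>0 + e\<^sub>1\<close>, \<open>e\<^sub>0 + e\<^sub>2\<close> and
  \<open>e\<^sub>1 + e\<^sub>2\<close> of the plane. The second product vanishes, because the columns \<open>0\<close>, \<open>1\<close> and \<open>3\<close> are
  dependent, and the first one is \<open>-1\<close>.\<close>

lemma conic_quartic_witness:
  assumes d: "2 \<le> d" and n: "d + 4 \<le> n"
  obtains Z where "Z \<in> carrier_mat (d + 1) n" "\<And>j. d + 4 \<le> j \<Longrightarrow> j < n \<Longrightarrow> col Z j = 0\<^sub>v (d + 1)"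
    "eval_at (minor Z) (conic_quartic [6..<d + 4]) \<noteq> 0"
proof
  define e :: "nat \<Rightarrow> complex vec" where "e = unit_vec (d + 1)"
  define z where "z j = (if j < 3 then e j else if j = 3 then e 0 + e 1 else if j = 4 then e 0 + e 2
    else if j = 5 then e 1 + e 2 else if j < d + 4 then e (j - 3) else 0\<^sub>v (d + 1))" for j
  define Z where "Z = mat (d + 1) n (\<lambda>(i, j). z j $ i)"
  have e: "e j \<in> carrier_vec (d + 1)" for j by (simp add: e_def)
  have z: "z j \<in> carrier_vec (d + 1)" for j using e by (simp add: z_def)
  show Z: "Z \<in> carrier_mat (d + 1) n" by (simp add: Z_def)
  have col: "col Z j = z j" if "j < n" for j
    using that z[of j] by (intro eq_vecI) (auto simp: Z_def)
  then show "col Z j = 0\<^sub>v (d + 1)" if "d + 4 \<le> j" "j < n" for j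
    using that d by (simp add: z_def)
  let ?hs = "map z [6..<d + 4]"
  let ?br = "\<lambda>i j k. col_det ([z i, z j, z k] @ ?hs)"
  interpret plane_bracket ?br
    by (rule plane_bracket_col_det) (use d z in auto)
  have "[z 0, z 1, z 2] @ ?hs = map e [0..<d + 1]"
  proof (rule nth_equalityI)
    fix j assume "j < length ([z 0, z 1, z 2] @ ?hs)"
    then have j: "j < d + 1" using d by simp
    show "([z 0, z 1, z 2] @ ?hs) ! j = map e [0..<d + 1] ! j"
    proof (cases "j < 3")
      case True
      then have "j \<in> {0, 1, 2}" by auto
      then have "([z 0, z 1, z 2] @ ?hs) ! j = z j" by auto
      also have "z j = e j" using True by (simp add: z_def)
      finally show ?thesis using j by (simp del: upt_Suc)
    next
      case False
      have len: "length [z 0, z 1, z 2] = 3" by simp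
      have "([z 0, z 1, z 2] @ ?hs) ! j = ?hs ! (j - 3)"
        unfolding nth_append len using False by (simp only: if_False)
      also have "?hs ! (j - 3) = z (6 + (j - 3))"
        using False j by simp
      also have "6 + (j - 3) = j + 3" using False by simp
      also have "z (j + 3) = e j"
        using False j by (simp add: z_def)
      finally show ?thesis using j by (simp del: upt_Suc)
    qed
  qed (use d in simp)
  then have b012: "?br 0 1 2 = 1"
    using col_det_unit_vecs[of "d + 1"] by (simp only: e_def)
  have add: "?br i j k = ?br a j k + ?br b j k" if "z i = z a + z b" for i a b j k
  proof -
    obtain \<omega> where "\<omega> \<in> carrier_vec (d + 1)"
      "\<And>v. v \<in> carrier_vec (d + 1) \<Longrightarrow> col_det ([] @ v # ([z j, z k] @ ?hs)) = \<omega> \<bullet> v"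
      by (rule col_det_linear[of "d + 1" "[]" "[z j, z k] @ ?hs"]) (use d in auto)
    with z that show ?thesis by (simp add: scalar_prod_add_distrib[of _ "d + 1"])
  qed
  have z3: "z 3 = z 0 + z 1" and z4: "z 4 = z 0 + z 2" and z5: "z 5 = z 1 + z 2"
    by (simp_all add: z_def)
  have b034: "?br 0 3 4 = 1"
    using rotate[of 0 3 4] add[OF z3, of 4 0] repeated(2)[of 0 4] rotate[of 1 4 0]
      add[OF z4, of 0 1] repeated(1)[of 0 1] rotate[of 2 0 1] b012 by simp
  have b135: "?br 1 3 5 = - 1"
    using rotate[of 1 3 5] add[OF z3, of 5 1] repeated(2)[of 1 5] rotate[of 0 5 1]
      add[OF z5, of 1 0] repeated(1)[of 1 0] rotate[of 2 1 0] swap12[of 1 0 2] b012 by simp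
  have b245: "?br 2 4 5 = 1"
    using rotate[of 2 4 5] add[OF z4, of 5 2] repeated(2)[of 2 5] rotate[of 0 5 2]
      add[OF z5, of 2 0] repeated(1)[of 2 0] rotate[of 1 2 0] rotate[of 2 0 1] b012 by simp
  have b013: "?br 0 1 3 = 0"
    using rotate[of 0 1 3] rotate[of 1 3 0] add[OF z3, of 0 1] repeated(1)[of 0 1] repeated(2)[of 1 0] by simp
  have br: "col_det (map (col Z) ([i, j, k] @ [6..<d + 4])) = ?br i j k" if "i < 6" "j < 6" "k < 6" for i j k
  proof -
    have "map (col Z) ([i, j, k] @ [6..<d + 4]) = [z i, z j, z k] @ ?hs"
      using that d n col by auto
    then show ?thesis by (rule arg_cong)
  qed
  let ?c = "\<lambda>i j k. col_det (map (col Z) ([i, j, k] @ [6..<d + 4]))"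
  have brackets_Z: "?c 0 1 2 = 1" "?c 0 3 4 = 1" "?c 1 3 5 = - 1" "?c 2 4 5 = 1" "?c 0 1 3 = 0"
    by (rule trans[OF br b012] trans[OF br b034] trans[OF br b135] trans[OF br b245] trans[OF br b013]; simp)+
  have hs: "length [6..<d + 4] + 3 = d + 1" "set [6..<d + 4] \<subseteq> {..<n}" "6 \<le> n"
    using d n by auto
  show "eval_at (minor Z) (conic_quartic [6..<d + 4]) \<noteq> 0"
    unfolding eval_at_conic_quartic[OF Z hs] brackets_Z by simp
qed

section \<open>Pascal points\<close>

text \<open>The brackets that express that \<open>q\<close> is the point in which the line \<open>u w\<close> meets the hyperplane through
  \<open>c\<close>, \<open>e\<close> and \<open>hs\<close>. The last one does not vanish because otherwise \<open>q\<close> would be a multiple of \<open>u\<close>,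
  which is not in the hyperplane.\<close>

lemma line_meets_hyperplane:
  assumes len: "length hs + 3 = r" and hs: "set hs \<subseteq> carrier_vec r"
    and carrier: "u \<in> carrier_vec r" "w \<in> carrier_vec r" "c \<in> carrier_vec r" "e \<in> carrier_vec r"
      "z \<in> carrier_vec r"
    and line: "q \<in> cspan r {u, w}" and hyp: "q \<in> cspan r ({c, e} \<union> set hs)"
    and q: "q \<noteq> 0\<^sub>v r"
    and general: "col_det ([u, w, z] @ hs) \<noteq> 0" "col_det ([c, e, u] @ hs) \<noteq> 0"
  shows "col_det ([u, w, q] @ hs) = 0" "col_det ([c, e, q] @ hs) = 0" "col_det ([u, z, q] @ hs) \<noteq> 0"
proof -
  obtain a b where ab: "q = a \<cdot>\<^sub>v u + b \<cdot>\<^sub>v w"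
    using span_pairE[OF carrier(1,2) line] .
  then have q_carrier: "q \<in> carrier_vec r" using carrier by simp
  have lin: "\<exists>\<omega>\<in>carrier_vec r. \<forall>v\<in>carrier_vec r. col_det ([s, t, v] @ hs) = \<omega> \<bullet> v" for s t
  proof -
    obtain \<omega> where "\<omega> \<in> carrier_vec r" "\<And>v. v \<in> carrier_vec r \<Longrightarrow> col_det ([s, t] @ v # hs) = \<omega> \<bullet> v"
      by (rule col_det_linear[of r "[s, t]" hs]) (use len in auto)
    then show ?thesis by auto
  qed
  have vanish: "col_det ([s, t, q] @ hs) = 0" if S: "q \<in> cspan r S" "S \<subseteq> {s, t} \<union> set hs" "S \<subseteq> carrier_vec r"
    for s t S
  proof -
    obtain \<omega> where \<omega>: "\<omega> \<in> carrier_vec r" "\<And>v. v \<in> carrier_vec r \<Longrightarrow> col_det ([s, t, v] @ hs) = \<omega> \<bullet> v"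
      using lin by blast
    have "\<omega> \<bullet> x = 0" if x: "x \<in> S" for x
    proof -
      have "col_det ([s, t, x] @ hs) = 0"
        using x S(2) by (intro col_det_not_distinct) auto
      then show ?thesis using \<omega>(2) x S(3) by auto
    qed
    then show ?thesis
      using \<omega> q_carrier scalar_prod_span_zero[OF \<omega>(1) S(3) _ S(1)] by simp
  qed
  show "col_det ([u, w, q] @ hs) = 0"
    by (rule vanish[OF line]) (use carrier in auto)
  show ceq: "col_det ([c, e, q] @ hs) = 0"
    by (rule vanish[OF hyp]) (use carrier hs in auto)
  have expand: "col_det ([s, t, q] @ hs) = a * col_det ([s, t, u] @ hs) + b * col_det ([s, t, w] @ hs)" for s t
  proof -
    obtain \<omega> where \<omega>: "\<omega> \<in> carrier_vec r" "\<And>v. v \<in> carrier_vec r \<Longrightarrow> col_det ([s, t, v] @ hs) = \<omega> \<bullet> v"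
      using lin by blast
    show ?thesis
      using \<omega> carrier q_carrier unfolding ab
      by (simp add: scalar_prod_add_distrib[of _ r])
  qed
  show "col_det ([u, z, q] @ hs) \<noteq> 0"
  proof
    assume "col_det ([u, z, q] @ hs) = 0"
    moreover have "col_det ([u, z, u] @ hs) = 0"
      by (rule col_det_not_distinct) simp
    moreover have "col_det ([u, z, w] @ hs) \<noteq> 0"
      using general(1) col_det_swap[of "[u]" z w hs] by simp
    ultimately have b: "b = 0" using expand[of u z] by simp
    then have "a = 0" using expand[of c e] ceq general(2) by simp
    with b ab carrier have "q = 0\<^sub>v r" by (intro eq_vecI) auto
    with q show False by simp
  qed
qed

lemma join_subset_span:
  assumes "\<And>i. i \<in> I \<Longrightarrow> homog_coords n (v i) (P i)"
  shows "join n (P ` I) \<subseteq> cspan n (v ` I)"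
proof -
  interpret vec_space "TYPE(complex)" n .
  have sub: "v ` I \<subseteq> carrier_vec n" using assms by (auto simp: homog_coords_def)
  have "P i \<subseteq> span (v ` I)" if "i \<in> I" for i
  proof -
    have "P i = span {v i}" using assms[OF that] by (simp add: homog_coords_def proj_point_def)
    also have "\<dots> \<subseteq> span (v ` I)"
      by (rule span_subsetI[OF sub]) (use in_own_span[OF sub] that in auto)
    finally show ?thesis .
  qed
  then show ?thesis
    unfolding join_def by (intro span_subsetI[OF sub]) auto
qed

lemma homog_coords_in: "homog_coords n v p \<Longrightarrow> v \<in> p"
proof -
  interpret vec_space "TYPE(complex)" n .
  assume "homog_coords n v p"
  then show "v \<in> p"
    using in_own_span[of "{v}"] by (auto simp: homog_coords_def proj_point_def)
qed

text \<open>The case \<open>l = {0, \<dots>, 5}\<close> in the definition of \<open>cs_points\<close>.\<close>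

lemma pascal_points:
  fixes d P defines "H \<equiv> {6..<d + 4}"
  assumes d: "2 \<le> d"
  shows "join (d + 1) (P ` {0, 1}) \<inter> join (d + 1) (P ` ({3, 4} \<union> H)) \<in> cs_points d P"
    and "join (d + 1) (P ` {1, 2}) \<inter> join (d + 1) (P ` ({4, 5} \<union> H)) \<in> cs_points d P"
    and "join (d + 1) (P ` {2, 3}) \<inter> join (d + 1) (P ` ({5, 0} \<union> H)) \<in> cs_points d P"
proof -
  let ?l = "{..<6 :: nat}"
  have pick_lt: "pick ?l k = k" if "k < 6" for k
  proof -
    have "map (pick ?l) [0..<6] = [0..<6]"
      using map_pick_eq_sorted_list_of_set[of ?l] by (simp add: lessThan_atLeast0)
    then have "map (pick ?l) [0..<6] ! k = [0..<6] ! k" by simp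
    with that show ?thesis by simp
  qed
  have pick: "pick ?l 0 = 0" "pick ?l 1 = 1" "pick ?l 2 = 2" "pick ?l 3 = 3" "pick ?l 4 = 4" "pick ?l 5 = 5"
    by (rule pick_lt, simp)+
  have l: "?l \<in> brackets 6 (d + 4)" using d by (auto simp: brackets_def)
  have H: "{..<d + 4} - ?l = H" by (auto simp: H_def)
  show "join (d + 1) (P ` {0, 1}) \<inter> join (d + 1) (P ` ({3, 4} \<union> H)) \<in> cs_points d P"
    "join (d + 1) (P ` {1, 2}) \<inter> join (d + 1) (P ` ({4, 5} \<union> H)) \<in> cs_points d P"
    "join (d + 1) (P ` {2, 3}) \<inter> join (d + 1) (P ` ({5, 0} \<union> H)) \<in> cs_points d P"
    unfolding cs_points_def
    by (rule UN_I[OF l], simp only: Let_def pick H image_Un image_insert image_empty, blast)+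
qed

section \<open>Nontrivial quartics\<close>

theorem theorem4p2p2:
  fixes d n :: nat and C :: "complex vec set set" and P Q :: "nat \<Rightarrow> complex vec set"
    and A :: "complex mat" and x :: "complex vec set"
  assumes "d \<ge> 2"
    and "rational_normal_curve d C"
    and "inj_on P {..<d + 4}"
    and "P ` {..<d + 4} \<subseteq> C"
    and "bij_betw Q {..<card (cs_points d P)} (cs_points d P)"
    and "n = d + 4 + card (cs_points d P)"
    and "A \<in> carrier_mat (d + 1) n"
    and "\<And>j. j < d + 4 \<Longrightarrow> homog_coords (d + 1) (col A j) (P j)"
    and "\<And>k. k < card (cs_points d P) \<Longrightarrow> homog_coords (d + 1) (col A (d + 4 + k)) (Q k)"
    and "x = cspan n (set (rows A))"
  shows "\<exists>f. homogeneous (d + 1) n 4 f \<and> nontrivial (d + 1) n x f"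
proof -
  note d = assms(1) and A = assms(7) and P_coords = assms(8) and Q_coords = assms(9)
  define hs where "hs = [6..<d + 4]"
  define \<phi> where "\<phi> = conic_quartic hs"
  have hs: "length hs + 3 = d + 1" "set hs \<subseteq> {..<n}" "6 \<le> n"
    using d assms(6) by (auto simp: hs_def)
  have set_hs: "set hs = {6..<d + 4}" by (simp add: hs_def)
  have col: "col A j \<in> carrier_vec (d + 1)" for j
    using A by (metis carrier_matD(1) col_dim)
  define br where "br M i j k = col_det (map (col M) ([i, j, k] @ hs))" for M i j k

  obtain c g where c: "c \<noteq> 0"
    and g: "\<And>i j. i \<in> {..<d + 4} \<Longrightarrow> j \<in> {..<d + 4} \<Longrightarrow> i \<noteq> j \<Longrightarrow> g i j \<noteq> 0"
    and det_curve: "\<And>js. length js = d + 1 \<Longrightarrow> set js \<subseteq> {..<d + 4} \<Longrightarrow>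
      col_det (map (col A) js) = c * pair_prod g js"
  proof (rule col_det_rational_normal_curve[OF _ assms(2-4)])
    show "d \<noteq> 0" using d by simp
    show "homog_coords (d + 1) (col A j) (P j)" if "j \<in> {..<d + 4}" for j
      using P_coords that by simp
  qed (rule that)
  have general: "col_det (map (col A) js) \<noteq> 0"
    if "length js = d + 1" "distinct js" "set js \<subseteq> {..<d + 4}" for js
  proof -
    have "pair_prod g js \<noteq> 0"
      by (rule pair_prod_nonzero) (use that g in auto)
    then show ?thesis using det_curve[OF that(1,3)] c by simp
  qed
  have br_nz: "br A i j k \<noteq> 0" if "i < 6" "j < 6" "k < 6" "i \<noteq> j" "i \<noteq> k" "j \<noteq> k" for i j k
    unfolding br_def by (rule general) (use that d hs in \<open>auto simp: hs_def\<close>)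

  have rep: "represents (d + 1) n A x"
  proof -
    have "col_det (map (col A) [0..<d + 1]) \<noteq> 0"
      by (rule general) (auto simp del: upt_Suc)
    moreover have "set [0..<d + 1] \<subseteq> {..<n}"
      using assms(6) by (auto simp del: upt_Suc)
    ultimately have "minor A (set [0..<d + 1]) \<noteq> 0"
      using col_det_eq_minor[OF A, of "[0..<d + 1]"] by (auto simp del: upt_Suc)
    moreover have "set [0..<d + 1] \<in> brackets (d + 1) n"
      using assms(6) by (auto simp: brackets_def simp del: upt_Suc)
    ultimately show ?thesis
      unfolding assms(10) using represents_row_span[OF A] by blast
  qed

  (* each pair of indices below 6 that occurs in a bracket of one product occurs, in the same order,
     in a bracket of the other; each index below 6 occurs twice, which accounts for the pairs with hs *)
  have on_curve: "eval_at (minor A) \<phi> = 0"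
  proof -
    have "br A i j k = c * pair_prod g ([i, j, k] @ hs)" if "i < 6" "j < 6" "k < 6" for i j k
      unfolding br_def by (rule det_curve) (use that d hs in \<open>auto simp: hs_def\<close>)
    then show ?thesis
      unfolding \<phi>_def eval_at_conic_quartic[OF A hs] br_def[symmetric] by (simp add: mult_ac)
  qed

  (* one side u w of the hexagon, the opposite side c e, and an auxiliary vertex z *)
  have side: "\<exists>q. q < n \<and> br A u w q = 0 \<and> br A c e q = 0 \<and> br A u z q \<noteq> 0"
    if Q: "join (d + 1) (P ` {u, w}) \<inter> join (d + 1) (P ` ({c, e} \<union> {6..<d + 4})) \<in> cs_points d P"
      and lt: "u < 6" "w < 6" "c < 6" "e < 6" "z < 6"
      and ne: "u \<noteq> w" "u \<noteq> z" "w \<noteq> z" "c \<noteq> e" "c \<noteq> u" "e \<noteq> u"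
    for u w c e z
  proof -
    obtain k where k: "k < card (cs_points d P)"
      and Qk: "Q k = join (d + 1) (P ` {u, w}) \<inter> join (d + 1) (P ` ({c, e} \<union> {6..<d + 4}))"
      using assms(5) Q unfolding bij_betw_def by (metis imageE lessThan_iff)
    let ?q = "col A (d + 4 + k)"
    have q: "?q \<in> Q k" "?q \<noteq> 0\<^sub>v (d + 1)"
      using Q_coords[OF k] homog_coords_in by (auto simp: homog_coords_def)
    have "join (d + 1) (P ` {u, w}) \<subseteq> cspan (d + 1) (col A ` {u, w})"
      by (rule join_subset_span) (use P_coords lt d in auto)
    moreover have "join (d + 1) (P ` ({c, e} \<union> {6..<d + 4})) \<subseteq> cspan (d + 1) (col A ` ({c, e} \<union> {6..<d + 4}))"
      by (rule join_subset_span) (use P_coords lt d in auto)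
    ultimately have line: "?q \<in> cspan (d + 1) {col A u, col A w}"
      and hyp: "?q \<in> cspan (d + 1) ({col A c, col A e} \<union> set (map (col A) hs))"
      using q(1) unfolding Qk by (auto simp: set_hs image_Un)
    have br: "br A i j l = col_det ([col A i, col A j, col A l] @ map (col A) hs)" for i j l
      by (simp add: br_def)
    have "br A u w (d + 4 + k) = 0 \<and> br A c e (d + 4 + k) = 0 \<and> br A u z (d + 4 + k) \<noteq> 0"
      unfolding br
      using line_meets_hyperplane[OF _ _ col col col col col line hyp q(2), of z]
        br_nz[of u w z] br_nz[of c e u] lt ne hs(1) col unfolding br by auto
    then show ?thesis
      using k assms(6) by (intro exI[of _ "d + 4 + k"]) simp
  qed
  obtain q1 where q1: "q1 < n" "br A 0 1 q1 = 0" "br A 3 4 q1 = 0" "br A 0 3 q1 \<noteq> 0"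
    using side[OF pascal_points(1)[OF d], of 3] by auto
  obtain q2 where q2: "q2 < n" "br A 1 2 q2 = 0" "br A 4 5 q2 = 0" "br A 1 3 q2 \<noteq> 0"
    using side[OF pascal_points(2)[OF d], of 3] by auto
  obtain q3 where q3: "q3 < n" "br A 2 3 q3 = 0" "br A 5 0 q3 = 0" "br A 2 0 q3 \<noteq> 0"
    using side[OF pascal_points(3)[OF d], of 0] by auto
  have swap: "br M i j k = - br M j i k" for M i j k
    using col_det_swap[of "[]" "col M i" "col M j"] by (simp add: br_def)

  (* this applies to A itself and to the matrices that represent points of its stratum *)
  have conic: "eval_at (minor B) \<phi> = 0 \<longleftrightarrow> br B q1 q2 q3 = 0"
    if B: "B \<in> carrier_mat (d + 1) n"
      and same: "\<And>js. length js = d + 1 \<Longrightarrow> set js \<subseteq> {..<n} \<Longrightarrow>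
        col_det (map (col B) js) = 0 \<longleftrightarrow> col_det (map (col A) js) = 0" for B
  proof -
    have br_same: "br B i j k = 0 \<longleftrightarrow> br A i j k = 0" if "i < n" "j < n" "k < n" for i j k
      unfolding br_def by (rule same) (use that hs in auto)
    have "br B 0 5 q3 = 0 \<longleftrightarrow> br A 5 0 q3 = 0" "br B 0 2 q3 = 0 \<longleftrightarrow> br A 2 0 q3 = 0"
      using br_same[of 0 5 q3] br_same[of 0 2 q3] q3(1) hs(3) swap[of A 0 5 q3] swap[of A 0 2 q3] by auto
    then show ?thesis
      unfolding \<phi>_def br_def
      by (intro conic_quartic_vanishes_iff[OF B hs]; unfold br_def[symmetric])
        (use br_same br_nz q1 q2 q3 hs(3) in auto)
  qed
  have collinear: "br A q1 q2 q3 = 0"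
    using conic[OF A] on_curve by simp

  have vanish: "eval_at (minor B) \<phi> = 0"
    if y: "y \<in> matroid_stratum (d + 1) n x" and B: "represents (d + 1) n B y" for y B
  proof -
    have same: "col_det (map (col B) js) = 0 \<longleftrightarrow> col_det (map (col A) js) = 0"
      if "length js = d + 1" "set js \<subseteq> {..<n}" for js
      by (rule col_det_zero_iff_of_same_matroid[OF rep B _ that]) (use y in \<open>simp add: matroid_stratum_def\<close>)
    (* if the Pascal points coincide the bracket has a repeated column, which same covers *)
    have "br B q1 q2 q3 = 0"
      using same[of "[q1, q2, q3] @ hs"] collinear q1(1) q2(1) q3(1) hs unfolding br_def by auto
    then show ?thesis
      using conic[OF _ same] B by (simp add: represents_def)
  qed
  have form: "\<phi> \<in> forms (brackets (d + 1) n) 4"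
    unfolding \<phi>_def by (rule conic_quartic_in_forms[OF hs])

  obtain Z where Z: "Z \<in> carrier_mat (d + 1) n"
    and Z_zero: "\<And>j. d + 4 \<le> j \<Longrightarrow> j < n \<Longrightarrow> col Z j = 0\<^sub>v (d + 1)"
    and Z_nz: "eval_at (minor Z) \<phi> \<noteq> 0"
    unfolding \<phi>_def hs_def by (rule conic_quartic_witness[of d n]) (use d assms(6) in auto)
  interpret Z: pluecker_point "d + 1" n "minor Z"
    by (rule pluecker_point_minor[OF Z])
  (* a nonbasis contains the index of a Pascal point, and there Z has a zero column *)
  have "minor Z l = 0" if l: "l \<in> brackets (d + 1) n - matroid_bases (d + 1) n x" for l
  proof -
    let ?js = "sorted_list_of_set l"
    have lb: "l \<in> brackets (d + 1) n" using l by simp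
    note js = brackets_sorted_list[OF lb]
    have "col_det (map (col A) ?js) = 0"
      using l matroid_bases_iff_minor[OF rep] minor_eq_col_det[OF A lb] by simp
    then have "\<not> set ?js \<subseteq> {..<d + 4}"
      using general[of ?js] js(2) by auto
    then have "\<exists>j\<in>l. d + 4 \<le> j"
      using js(3) by (metis lessThan_iff not_less subsetI)
    then obtain j where j: "j \<in> l" "d + 4 \<le> j" by blast
    then have "j < n" using js(4) by auto
    have "col Z j = 0\<^sub>v (d + 1)" by (rule Z_zero[OF j(2) \<open>j < n\<close>])
    then have "0\<^sub>v (d + 1) \<in> set (map (col Z) ?js)"
      using j(1) js(3) by (metis imageI list.set_map)
    then obtain us vs where split: "map (col Z) ?js = us @ 0\<^sub>v (d + 1) # vs"
      by (meson split_list)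
    have "d + 1 = Suc (length us + length vs)"
      using arg_cong[OF split, of length] js(2) by simp
    then obtain \<omega> where "\<omega> \<in> carrier_vec (d + 1)"
      "\<And>v. v \<in> carrier_vec (d + 1) \<Longrightarrow> col_det (us @ v # vs) = \<omega> \<bullet> v"
      by (rule col_det_linear) (rule that)
    then show ?thesis
      using minor_eq_col_det[OF Z lb] split by simp
  qed
  then have "residue_class (d + 1) n \<phi> \<notin> nonbasis_ideal (d + 1) n x"
    by (rule Z.notin_nonbasis_ideal) (use form Z_nz in \<open>auto simp: forms_def\<close>)
  moreover have "residue_class (d + 1) n \<phi> \<in> matroid_ideal (d + 1) n x"
    by (rule residue_class_in_matroid_ideal[OF form vanish])
  ultimately show ?thesis
    using form unfolding nontrivial_def homogeneous_def by blast
qed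

end
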